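(* In the setting described in the context, let $\alpha\in(0,1)$ and assume that there exists a constant $C_1$ such that, for every $k\in[1,n]$, $$\mathbb E\Big[\exp\Big(\big(H_{k,\varepsilon_k}(X_{k-1},\ldots,X_1,\varepsilon_k)\big)^{\frac{2\alpha}{1-\alpha}}\Big)\Big]\le C_1.$$ Then, for either choice of sign and every $x>0$, $$\mathbb P(\pm S_n\ge nx)\le C(\alpha,x)\exp\Big(-\Big(\frac{x}{8\,a_{n-1}(n-1)}\Big)^{2\alpha}n^\alpha\Big),$$ where $$C(\alpha,x)=2+35\,C_1\left(\frac{(a_{n-1}(n-1))^{2\alpha}}{x^{2\alpha}\,4^{2-3\alpha}}+\frac{4\,(a_{n-1}(n-1))^2}{x^2}\Big(\frac{3(1-\alpha)}{2\alpha}\Big)^{\frac{1-\alpha}{\alpha}}\right),$$ which depends on $n$ only through $a_{n-1}(n-1)$.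
   Context: Let $(\mathcal X,d)$ and $(\mathcal Y,\delta)$ be complete separable metric spaces. Let $(\varepsilon_i)_{i\ge1}$ be independent (not necessarily identically distributed) $\mathcal Y$-valued random variables, with $P_{\varepsilon_k}$ the law of $\varepsilon_k$. Let $(X_i)_{i\le0}$ be a deterministic sequence in $\mathcal X$. For each $m\ge1$ let $F_m:\mathcal X^{\mathbb N}\times\mathcal Y\to\mathcal X$ be measurable, and define recursively $X_m=F_m((X_{m-i})_{i\ge1};\varepsilon_m)$ for $m\ge1$. Assume there are nonnegative numbers $a_i$, $i\ge1$, with $\sum_{i\ge1}a_i<1$, such that for all $m\ge1$ and all sequences $(x_{m-i})_{i\ge1},(x'_{m-i})_{i\ge1}$ in $\mathcal X$, $$\mathbb E\big[d\big(F_m((x_{m-i})_{i\ge1};\varepsilon_m),F_m((x'_{m-i})_{i\ge1};\varepsilon_m)\big)\big]\le\sum_{i=1}^\infty a_i\,d(x_{m-i},x'_{m-i}).$$ Fix $n\ge1$ and let $f:\mathcal X^n\to\mathbb R$ satisfy $|f(x_1,\ldots,x_n)-f(x'_1,\ldots,x'_n)|\le\sum_{i=1}^n d(x_i,x'_i)$. Put $S_n=f(X_1,\ldots,X_n)-\mathbb E[f(X_1,\ldots,X_n)]$. The numbers $a_k(k)$, $k\ge0$, are defined recursively by $a_0(0)=1$ and $a_k(k)=1+a_k+\sum_{l=1}^{k-1}a_l(l)\,a_{k-l}$ for $k\ge1$ (so $a_1(1)=1+a_1$). For $k\ge1$, $$H_{k,\varepsilon_k}(X_{k-1},\ldots,X_1,\varepsilon_k)=\int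 d\big(F_k(X_{k-1},\ldots,X_1,X_0,X_{-1},\ldots;\varepsilon_k),F_k(X_{k-1},\ldots,X_1,X_0,X_{-1},\ldots;y)\big)P_{\varepsilon_k}(dy),$$ which for $k=1$ is $H_{1,\varepsilon_1}(\varepsilon_1)=\int d(F_1(X_0,X_{-1},\ldots;\varepsilon_1),F_1(X_0,X_{-1},\ldots;y))P_{\varepsilon_1}(dy)$. *)

theory Defs
  imports "HOL-Probability.Probability"
begin

text \<open>
  A point of the one-sided sequence space is a function \<open>z :: nat \<Rightarrow> 'x\<close>, indexed from \<open>0\<close>:
  as an argument of the \<open>m\<close>-th map \<open>F m\<close>, the entry \<open>z j\<close> is the coordinate $x_{m-1-j}$
  (most recent state first).  The process \<open>X\<close> is indexed by the integers, and \<open>past X m \<omega>\<close> is the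
  sequence $(X_{m-1}(\omega), X_{m-2}(\omega), \ldots)$.
\<close>

definition past :: "(int \<Rightarrow> 'w \<Rightarrow> 'x) \<Rightarrow> nat \<Rightarrow> 'w \<Rightarrow> nat \<Rightarrow> 'x" where
  "past X m \<omega> = (\<lambda>j. X (int m - 1 - int j) \<omega>)"

text \<open>The numbers $a_k(k)$; only the values \<open>a i\<close> with \<open>i \<ge> 1\<close> are used.\<close>

fun adiag :: "(nat \<Rightarrow> real) \<Rightarrow> nat \<Rightarrow> real" where
  "adiag a 0 = 1"
| "adiag a (Suc k) = 1 + a (Suc k) + (\<Sum>l=1..k. adiag a l * a (Suc k - l))"

text \<open>
  With \<open>P\<close> the law of the \<open>k\<close>-th innovation, \<open>G = F k\<close> and \<open>z = past X k \<omega>\<close> this is the function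
  $H_{k,\varepsilon_k}$.  It takes values in \<open>ennreal\<close>, since nothing guarantees a priori that the
  integral is finite (the Bochner integral would then be \<open>0\<close>).
\<close>

definition Hfun ::
  "'y measure \<Rightarrow> ((nat \<Rightarrow> 'x::metric_space) \<Rightarrow> 'y \<Rightarrow> 'x) \<Rightarrow> (nat \<Rightarrow> 'x) \<Rightarrow> 'y \<Rightarrow> ennreal" where
  "Hfun P G z e = (\<integral>\<^sup>+y. ennreal (dist (G z e) (G z y)) \<partial>P)"

text \<open>The function $h \mapsto \exp(h^p)$ on $[0,\infty]$, for \<open>p > 0\<close>.\<close>

definition exp_powr :: "real \<Rightarrow> ennreal \<Rightarrow> ennreal" where
  "exp_powr p h = (if h = \<top> then \<top> else ennreal (exp (enn2real h powr p)))"

definition centered_f ::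
  "'w measure \<Rightarrow> (int \<Rightarrow> 'w \<Rightarrow> 'x) \<Rightarrow> ((nat \<Rightarrow> 'x) \<Rightarrow> real) \<Rightarrow> 'w \<Rightarrow> real" where
  "centered_f M X f \<omega> = f (\<lambda>i. X (int i) \<omega>) - (\<integral>\<omega>'. f (\<lambda>i. X (int i) \<omega>') \<partial>M)"

text \<open>The constant $C(\alpha,x)$, with \<open>A\<close> standing for $a_{n-1}(n-1)$.\<close>

definition Cconst :: "real \<Rightarrow> real \<Rightarrow> real \<Rightarrow> real \<Rightarrow> real" where
  "Cconst C1 A \<alpha> x =
     2 + 35 * C1 * (A powr (2 * \<alpha>) / (x powr (2 * \<alpha>) * 4 powr (2 - 3 * \<alpha>))
                    + 4 * A\<^sup>2 / x\<^sup>2 * (3 * (1 - \<alpha>) / (2 * \<alpha>)) powr ((1 - \<alpha>) / \<alpha>))"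

end

theory Submission
  imports Defs
begin

text \<open>
  Averaging \<open>f\<close> over the innovations one at a time, the last one first, gives functions of the past
  whose increments along the chain sum up to $S_n$. By the contraction property these functions are
  Lipschitz in their most recent coordinate with constant $a_m(m)$ after \<open>m\<close> averagings, so the
  increment at time \<open>k\<close> has conditional mean \<open>0\<close> and is at most $a_{n-1}(n-1)\, H_k$ in absolute value.
  The increments are then truncated at a level of their envelope $H_k$: the recentred bounded parts are
  handled by Hoeffding's lemma, the recentred remainders by Chebyshev's inequality and the exponential
  moment. Since the state and the next innovation are independent, conditional expectations are just
  integrals over the next innovation with the state frozen.
\<close>

text \<open>The truncation level \<open>u\<close> balances two exponents. With b = y sqrt(n) / 8 and
  y = x / a_{n-1}(n-1), Hoeffding's lemma gives 8 b^2 / u^2 and the exponential moment gives u^p,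
  where p = 2 \<alpha> / (1 - \<alpha>). Since p + 2 = 2 / (1 - \<alpha>), the quantities b^2 / u^2
  and u^p agree exactly for u = b^(1 - \<alpha>), and both are then b^(2 \<alpha>), the claimed
  exponent. The obstacle is integrability: a Bochner integral that does not exist is 0, and nothing
  says beforehand that the averages exist. The exponential moment makes the mean of H_k finite, so
  H_k is finite for at least one history, and contraction carries this over to all others. It can,
  because two histories at time k share the deterministic past, which leaves finitely many nonzero
  terms in the series; the Lipschitz estimates are therefore proved on histories only. The numbers
  a_m(m) solve a renewal equation: averaging out the newest coordinate spreads its weight a_m(m)
  over the older ones with factors a_i, on top of the weight 1 that each has in f.\<close>

section \<open>Chains driven by independent innovations\<close>

locale innovation_chain = prob_space M for M :: "'w measure" +
  fixes Y :: "'y measure" and e :: "nat \<Rightarrow> 'w \<Rightarrow> 'y"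
    and N :: "'s measure" and T :: "nat \<Rightarrow> 's \<Rightarrow> 'y \<Rightarrow> 's"
    and Z :: "nat \<Rightarrow> 'w \<Rightarrow> 's" and z0 :: 's
  assumes indep: "indep_vars (\<lambda>_. Y) e UNIV"
    and T_measurable: "\<And>k. (\<lambda>(z, y). T k z y) \<in> N \<Otimes>\<^sub>M Y \<rightarrow>\<^sub>M N"
    and z0_space: "z0 \<in> space N"
    and Z_0: "\<And>\<omega>. \<omega> \<in> space M \<Longrightarrow> Z 0 \<omega> = z0"
    and Z_Suc: "\<And>k \<omega>. \<omega> \<in> space M \<Longrightarrow> Z (Suc k) \<omega> = T k (Z k \<omega>) (e k \<omega>)"
begin

abbreviation law :: "nat \<Rightarrow> 'y measure" where
  "law k \<equiv> distr M Y (e k)"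

lemma e_measurable [measurable]: "e k \<in> M \<rightarrow>\<^sub>M Y"
  using indep by (auto simp: indep_vars_def)

lemma prob_space_law: "prob_space (law k)"
  by (rule prob_space_distr) simp

text \<open>Unrolling the recursion never meets \<open>e k\<close>, which is what makes the state at
  time \<open>k\<close> independent of it. Equality is claimed on \<open>space M\<close> only,
  because the recursion is.\<close>

lemma state_function_of_innovations:
  "\<exists>g \<in> PiM {..<k} (\<lambda>_. Y) \<rightarrow>\<^sub>M N. \<forall>\<omega>\<in>space M. Z k \<omega> = g (restrict (\<lambda>i. e i \<omega>) {..<k})"
proof (induction k)
  case 0
  show ?case
    by (rule bexI[of _ "\<lambda>_. z0"]) (auto simp: Z_0 z0_space)
next
  case (Suc k)
  then obtain g where g [measurable]: "g \<in> PiM {..<k} (\<lambda>_. Y) \<rightarrow>\<^sub>M N"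
    and Zg: "\<And>\<omega>. \<omega> \<in> space M \<Longrightarrow> Z k \<omega> = g (restrict (\<lambda>i. e i \<omega>) {..<k})"
    by blast
  have r [measurable]: "(\<lambda>w. restrict w {..<k}) \<in> PiM {..<Suc k} (\<lambda>_. Y) \<rightarrow>\<^sub>M PiM {..<k} (\<lambda>_. Y)"
    by (rule measurable_restrict_subset) auto
  have c [measurable]: "(\<lambda>w. w k) \<in> PiM {..<Suc k} (\<lambda>_. Y) \<rightarrow>\<^sub>M Y"
    by (rule measurable_component_singleton) auto
  have m: "(\<lambda>w. T k (g (restrict w {..<k})) (w k)) \<in> PiM {..<Suc k} (\<lambda>_. Y) \<rightarrow>\<^sub>M N"
    using measurable_compose[OF measurable_Pair[OF measurable_compose[OF r g] c] T_measurable[of k]]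
    by simp
  have rr: "restrict (restrict (\<lambda>i. e i \<omega>) {..<Suc k}) {..<k} = restrict (\<lambda>i. e i \<omega>) {..<k}" for \<omega>
    by (auto simp: restrict_def)
  show ?case
  proof (rule bexI[OF _ m], rule ballI)
    fix \<omega> assume \<omega>: "\<omega> \<in> space M"
    have "restrict (\<lambda>i. e i \<omega>) {..<Suc k} k = e k \<omega>"
      by simp
    then show "Z (Suc k) \<omega> = T k (g (restrict (restrict (\<lambda>i. e i \<omega>) {..<Suc k}) {..<k}))
        (restrict (\<lambda>i. e i \<omega>) {..<Suc k} k)"
      by (simp only: Z_Suc[OF \<omega>] Zg[OF \<omega>] rr)
  qed
qed

lemma Z_measurable [measurable]: "Z k \<in> M \<rightarrow>\<^sub>M N"
proof -
  obtain g where g [measurable]: "g \<in> PiM {..<k} (\<lambda>_. Y) \<rightarrow>\<^sub>M N"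
    and Zg: "\<And>\<omega>. \<omega> \<in> space M \<Longrightarrow> Z k \<omega> = g (restrict (\<lambda>i. e i \<omega>) {..<k})"
    using state_function_of_innovations by blast
  have "(\<lambda>\<omega>. g (restrict (\<lambda>i. e i \<omega>) {..<k})) \<in> M \<rightarrow>\<^sub>M N"
    by measurable
  then show ?thesis
    by (subst measurable_cong[OF Zg])
qed

lemma Z_space: "\<omega> \<in> space M \<Longrightarrow> Z k \<omega> \<in> space N"
  using Z_measurable by (rule measurable_space)

text \<open>\<open>Z k\<close> and \<open>e k\<close> are functions of the disjoint blocks
  \<open>{..<k}\<close> and \<open>{k}\<close> of the independent family. The blocks have a product
  law, and a coordinatewise image of a product law is again one.\<close>

lemma joint_law: "distr M (N \<Otimes>\<^sub>M Y) (\<lambda>\<omega>. (Z k \<omega>, e k \<omega>)) = distr M N (Z k) \<Otimes>\<^sub>M law k"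
proof -
  obtain g where g [measurable]: "g \<in> PiM {..<k} (\<lambda>_. Y) \<rightarrow>\<^sub>M N"
    and Zg: "\<And>\<omega>. \<omega> \<in> space M \<Longrightarrow> Z k \<omega> = g (restrict (\<lambda>i. e i \<omega>) {..<k})"
    using state_function_of_innovations by blast
  let ?P = "PiM {..<k} (\<lambda>_. Y)" and ?Q = "PiM {k} (\<lambda>_. Y)"
  let ?p = "\<lambda>\<omega>. restrict (\<lambda>i. e i \<omega>) {..<k}" and ?q = "\<lambda>\<omega>. restrict (\<lambda>i. e i \<omega>) {k}"
  have c [measurable]: "(\<lambda>w. w k) \<in> ?Q \<rightarrow>\<^sub>M Y"
    by (rule measurable_component_singleton) simp
  have "indep_var ?P ?p ?Q ?q"
    by (rule indep_var_restrict[OF indep]) auto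
  then have pq: "distr M ?P ?p \<Otimes>\<^sub>M distr M ?Q ?q = distr M (?P \<Otimes>\<^sub>M ?Q) (\<lambda>\<omega>. (?p \<omega>, ?q \<omega>))"
    by (simp add: indep_var_distribution_eq)
  have law: "distr (distr M ?Q ?q) Y (\<lambda>w. w k) = law k"
    by (subst distr_distr) (simp_all add: comp_def)
  have Zlaw: "distr (distr M ?P ?p) N g = distr M N (Z k)"
    by (subst distr_distr) (auto simp: Zg intro!: distr_cong)
  interpret L: prob_space "law k" by (rule prob_space_law)
  have "distr M N (Z k) \<Otimes>\<^sub>M law k
      = distr (distr M ?P ?p \<Otimes>\<^sub>M distr M ?Q ?q) (N \<Otimes>\<^sub>M Y) (\<lambda>(x, y). (g x, y k))"
    unfolding law[symmetric] Zlaw[symmetric]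
    by (rule pair_measure_distr) (auto simp: law L.sigma_finite_measure_axioms)
  also have "\<dots> = distr M (N \<Otimes>\<^sub>M Y) (\<lambda>\<omega>. (Z k \<omega>, e k \<omega>))"
    unfolding pq by (subst distr_distr) (auto simp: Zg intro!: distr_cong)
  finally show ?thesis by simp
qed

lemma nn_integral_step:
  assumes [measurable]: "\<phi> \<in> borel_measurable (N \<Otimes>\<^sub>M Y)"
  shows "(\<integral>\<^sup>+\<omega>. \<phi> (Z k \<omega>, e k \<omega>) \<partial>M) = (\<integral>\<^sup>+\<omega>. \<integral>\<^sup>+y. \<phi> (Z k \<omega>, y) \<partial>law k \<partial>M)"
proof -
  interpret L: prob_space "law k" by (rule prob_space_law)
  have "(\<integral>\<^sup>+\<omega>. \<phi> (Z k \<omega>, e k \<omega>) \<partial>M) = (\<integral>\<^sup>+v. \<phi> v \<partial>(distr M N (Z k) \<Otimes>\<^sub>M law k))"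
    by (subst joint_law[symmetric]) (simp add: nn_integral_distr)
  also have "\<dots> = (\<integral>\<^sup>+z. \<integral>\<^sup>+y. \<phi> (z, y) \<partial>law k \<partial>distr M N (Z k))"
    by (rule L.nn_integral_fst[symmetric]) measurable
  also have "\<dots> = (\<integral>\<^sup>+\<omega>. \<integral>\<^sup>+y. \<phi> (Z k \<omega>, y) \<partial>law k \<partial>M)"
    by (rule nn_integral_distr) measurable
  finally show ?thesis .
qed

lemma expectation_step_eq_0:
  fixes \<phi> :: "'s \<times> 'y \<Rightarrow> real"
  assumes [measurable]: "\<phi> \<in> borel_measurable (N \<Otimes>\<^sub>M Y)"
    and int: "integrable M (\<lambda>\<omega>. \<phi> (Z k \<omega>, e k \<omega>))"
    and zero: "\<And>\<omega>. \<omega> \<in> space M \<Longrightarrow> (\<integral>y. \<phi> (Z k \<omega>, y) \<partial>law k) = 0"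
  shows "expectation (\<lambda>\<omega>. \<phi> (Z k \<omega>, e k \<omega>)) = 0"
proof -
  interpret L: prob_space "law k" by (rule prob_space_law)
  interpret S: prob_space "distr M N (Z k)" by (rule prob_space_distr) measurable
  interpret P: pair_sigma_finite "distr M N (Z k)" "law k" ..
  have i: "integrable (distr M N (Z k) \<Otimes>\<^sub>M law k) \<phi>"
    using int by (subst joint_law[symmetric]) (simp add: integrable_distr_eq)
  have "expectation (\<lambda>\<omega>. \<phi> (Z k \<omega>, e k \<omega>)) = (\<integral>v. \<phi> v \<partial>(distr M N (Z k) \<Otimes>\<^sub>M law k))"
    by (subst joint_law[symmetric]) (simp add: integral_distr)
  also have "\<dots> = (\<integral>z. \<integral>y. \<phi> (z, y) \<partial>law k \<partial>distr M N (Z k))"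
    by (rule P.integral_fst'[OF i, symmetric])
  also have "\<dots> = (\<integral>\<omega>. \<integral>y. \<phi> (Z k \<omega>, y) \<partial>law k \<partial>M)"
    by (rule integral_distr) measurable
  also have "\<dots> = 0"
    using zero by (simp cong: Bochner_Integration.integral_cong)
  finally show ?thesis .
qed

text \<open>Integrating over one step sees only the current state, whereas a partial sum depends on
  the whole path. Carrying the sum along as a second component of the state gives a chain of the
  same kind.\<close>

lemma augmented_chain:
  assumes D [measurable]: "\<And>k. D k \<in> borel_measurable (N \<Otimes>\<^sub>M Y)"
  shows "innovation_chain M Y e (N \<Otimes>\<^sub>M (borel :: real measure))
    (\<lambda>k zs y. (T k (fst zs) y, snd zs + D k (fst zs, y)))
    (\<lambda>k \<omega>. (Z k \<omega>, \<Sum>i<k. D i (Z i \<omega>, e i \<omega>))) (z0, 0)"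
proof
  show "indep_vars (\<lambda>_. Y) e UNIV" by (rule indep)
  show "(\<lambda>(zs, y). (T k (fst zs) y, snd zs + D k (fst zs, y)))
      \<in> (N \<Otimes>\<^sub>M borel) \<Otimes>\<^sub>M Y \<rightarrow>\<^sub>M N \<Otimes>\<^sub>M (borel :: real measure)" for k
  proof -
    have p: "(\<lambda>v. (fst (fst v), snd v)) \<in> (N \<Otimes>\<^sub>M (borel :: real measure)) \<Otimes>\<^sub>M Y \<rightarrow>\<^sub>M N \<Otimes>\<^sub>M Y"
      by measurable
    have "(\<lambda>v. T k (fst (fst v)) (snd v)) \<in> (N \<Otimes>\<^sub>M (borel :: real measure)) \<Otimes>\<^sub>M Y \<rightarrow>\<^sub>M N"
      using measurable_compose[OF p T_measurable[of k]] by simp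
    moreover have "(\<lambda>v. snd (fst v) + D k (fst (fst v), snd v))
        \<in> borel_measurable ((N \<Otimes>\<^sub>M (borel :: real measure)) \<Otimes>\<^sub>M Y)"
      by measurable
    ultimately show ?thesis
      by (simp add: split_beta measurable_Pair)
  qed
qed (auto simp: Z_0 Z_Suc z0_space space_pair_measure)

lemma nn_integral_step_sum:
  fixes D :: "nat \<Rightarrow> 's \<times> 'y \<Rightarrow> real"
  assumes D [measurable]: "\<And>k. D k \<in> borel_measurable (N \<Otimes>\<^sub>M Y)"
    and \<phi>: "\<phi> \<in> borel_measurable ((N \<Otimes>\<^sub>M borel) \<Otimes>\<^sub>M Y)"
  shows "(\<integral>\<^sup>+\<omega>. \<phi> ((Z k \<omega>, \<Sum>i<k. D i (Z i \<omega>, e i \<omega>)), e k \<omega>) \<partial>M)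
    = (\<integral>\<^sup>+\<omega>. \<integral>\<^sup>+y. \<phi> ((Z k \<omega>, \<Sum>i<k. D i (Z i \<omega>, e i \<omega>)), y) \<partial>law k \<partial>M)"
  by (rule innovation_chain.nn_integral_step[OF augmented_chain[OF D] \<phi>])

section \<open>Moments of sums of recentred increments\<close>

definition centred :: "(nat \<Rightarrow> 's \<times> 'y \<Rightarrow> real) \<Rightarrow> nat \<Rightarrow> 's \<times> 'y \<Rightarrow> real" where
  "centred D k = (\<lambda>(z, y). D k (z, y) - (\<integral>y'. D k (z, y') \<partial>law k))"

lemma centred_measurable [measurable]:
  assumes [measurable]: "\<And>k. D k \<in> borel_measurable (N \<Otimes>\<^sub>M Y)"
  shows "centred D k \<in> borel_measurable (N \<Otimes>\<^sub>M Y)"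
proof -
  interpret L: prob_space "law k" by (rule prob_space_law)
  have "(\<lambda>z. \<integral>y'. D k (z, y') \<partial>law k) \<in> borel_measurable N"
    by (rule L.borel_measurable_lebesgue_integral) simp
  then show ?thesis
    unfolding centred_def by measurable
qed

text \<open>Given the state, the last summand is a centred variable with range in an interval of
  length \<open>2 * u\<close>, so Hoeffding's lemma contributes the factor
  \<open>exp (l^2 * (2 * u)^2 / 8)\<close>. The bound on \<open>D\<close> is asked for every
  \<open>y\<close> at each reached state, since \<open>y\<close> is integrated with the state
  frozen.\<close>

lemma exp_moment_bound:
  assumes D [measurable]: "\<And>k. D k \<in> borel_measurable (N \<Otimes>\<^sub>M Y)"
    and bdd: "\<And>k \<omega> y. k < n \<Longrightarrow> \<omega> \<in> space M \<Longrightarrow> y \<in> space Y \<Longrightarrow> \<bar>D k (Z k \<omega>, y)\<bar> \<le> u"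
    and l: "l > 0"
  shows "(\<integral>\<^sup>+\<omega>. ennreal (exp (l * (\<Sum>k<n. centred D k (Z k \<omega>, e k \<omega>)))) \<partial>M)
    \<le> ennreal (exp (real n * (l\<^sup>2 * u\<^sup>2 / 2)))"
  using bdd
proof (induction n)
  case 0
  then show ?case by (simp add: emeasure_space_1)
next
  case (Suc n)
  interpret L: prob_space "law n" by (rule prob_space_law)
  let ?S = "\<lambda>\<omega>. \<Sum>k<n. centred D k (Z k \<omega>, e k \<omega>)"
  let ?\<phi> = "\<lambda>v. ennreal (exp (l * (snd (fst v) + centred D n (fst (fst v), snd v))))"
  have m: "?\<phi> \<in> borel_measurable ((N \<Otimes>\<^sub>M borel) \<Otimes>\<^sub>M Y)"
    by measurable
  have step: "(\<integral>\<^sup>+y. ?\<phi> ((Z n \<omega>, ?S \<omega>), y) \<partial>law n)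
      \<le> ennreal (exp (l * ?S \<omega>)) * ennreal (exp (l\<^sup>2 * u\<^sup>2 / 2))" if \<omega>: "\<omega> \<in> space M" for \<omega>
  proof -
    have Zs: "Z n \<omega> \<in> space N"
      using \<omega> by (rule Z_space)
    have b: "AE y in law n. \<bar>D n (Z n \<omega>, y)\<bar> \<le> u"
      using Suc.prems[of n \<omega>] \<omega> by (intro AE_I2) auto
    interpret I: interval_bounded_random_variable "law n" "\<lambda>y. D n (Z n \<omega>, y)" "-u" u
    proof
      show "L.random_variable borel (\<lambda>y. D n (Z n \<omega>, y))"
        using Zs by measurable
      show "AE y in law n. D n (Z n \<omega>, y) \<in> {-u..u}"
        using b by eventually_elim auto
    qed
    have [measurable]: "(\<lambda>y. D n (Z n \<omega>, y)) \<in> borel_measurable Y"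
      using Zs by measurable
    have "(\<integral>\<^sup>+y. ?\<phi> ((Z n \<omega>, ?S \<omega>), y) \<partial>law n)
        = (\<integral>\<^sup>+y. ennreal (exp (l * ?S \<omega>)) *
            ennreal (exp (l * (D n (Z n \<omega>, y) - L.expectation (\<lambda>y. D n (Z n \<omega>, y))))) \<partial>law n)"
      by (simp add: centred_def distrib_left exp_add ennreal_mult)
    also have "\<dots> = ennreal (exp (l * ?S \<omega>)) *
        (\<integral>\<^sup>+y. ennreal (exp (l * (D n (Z n \<omega>, y) - L.expectation (\<lambda>y. D n (Z n \<omega>, y))))) \<partial>law n)"
      by (rule nn_integral_cmult) measurable
    also have "\<dots> \<le> ennreal (exp (l * ?S \<omega>)) * ennreal (exp (l\<^sup>2 * u\<^sup>2 / 2))"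
      using I.Hoeffdings_lemma_nn_integral[OF l]
      by (intro mult_left_mono) (auto simp: power2_eq_square field_simps)
    finally show ?thesis .
  qed
  have "(\<integral>\<^sup>+\<omega>. ennreal (exp (l * (\<Sum>k<Suc n. centred D k (Z k \<omega>, e k \<omega>)))) \<partial>M)
      = (\<integral>\<^sup>+\<omega>. ?\<phi> ((Z n \<omega>, ?S \<omega>), e n \<omega>) \<partial>M)"
    by simp
  also have "\<dots> = (\<integral>\<^sup>+\<omega>. \<integral>\<^sup>+y. ?\<phi> ((Z n \<omega>, ?S \<omega>), y) \<partial>law n \<partial>M)"
    by (rule nn_integral_step_sum[OF _ m]) measurable
  also have "\<dots> \<le> (\<integral>\<^sup>+\<omega>. ennreal (exp (l * ?S \<omega>)) * ennreal (exp (l\<^sup>2 * u\<^sup>2 / 2)) \<partial>M)"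
    by (rule nn_integral_mono) (rule step)
  also have "\<dots> = (\<integral>\<^sup>+\<omega>. ennreal (exp (l * ?S \<omega>)) \<partial>M) * ennreal (exp (l\<^sup>2 * u\<^sup>2 / 2))"
    by (rule nn_integral_multc) measurable
  also have "\<dots> \<le> ennreal (exp (real n * (l\<^sup>2 * u\<^sup>2 / 2))) * ennreal (exp (l\<^sup>2 * u\<^sup>2 / 2))"
    by (rule mult_right_mono) (use Suc in auto)
  also have "\<dots> = ennreal (exp (real (Suc n) * (l\<^sup>2 * u\<^sup>2 / 2)))"
    by (simp add: ennreal_mult[symmetric] exp_add[symmetric] algebra_simps add_divide_distrib)
  finally show ?case .
qed

text \<open>The cross term integrates to 0 and a variance is at most the second moment. If the
  second moment is infinite the claim is trivial, so no integrability has to be assumed.\<close>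

lemma second_moment_centred:
  assumes z: "z \<in> space N" and D [measurable]: "\<And>k. D k \<in> borel_measurable (N \<Otimes>\<^sub>M Y)"
  shows "(\<integral>\<^sup>+y. ennreal ((s + centred D k (z, y))\<^sup>2) \<partial>law k)
    \<le> ennreal (s\<^sup>2) + (\<integral>\<^sup>+y. ennreal ((D k (z, y))\<^sup>2) \<partial>law k)"
proof (cases "(\<integral>\<^sup>+y. ennreal ((D k (z, y))\<^sup>2) \<partial>law k) = \<top>")
  case False
  interpret L: prob_space "law k" by (rule prob_space_law)
  have m [measurable]: "(\<lambda>y. D k (z, y)) \<in> borel_measurable Y"
    using z by measurable
  have i2: "integrable (law k) (\<lambda>y. (D k (z, y))\<^sup>2)"
    using False by (intro integrableI_bounded) (auto simp: top.not_eq_extremum)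
  have i1: "integrable (law k) (\<lambda>y. D k (z, y))"
    by (rule L.square_integrable_imp_integrable[OF _ i2]) simp
  define \<mu> where "\<mu> = (\<integral>y. D k (z, y) \<partial>law k)"
  have eq: "(s + (x - \<mu>))\<^sup>2 = x\<^sup>2 + 2 * (s - \<mu>) * x + (s - \<mu>)\<^sup>2" for x
    by (simp add: power2_eq_square algebra_simps)
  have int: "integrable (law k) (\<lambda>y. (s + (D k (z, y) - \<mu>))\<^sup>2)"
    unfolding eq using i1 i2 by auto
  have "(\<integral>y. (s + (D k (z, y) - \<mu>))\<^sup>2 \<partial>law k)
      = (\<integral>y. (D k (z, y))\<^sup>2 \<partial>law k) + 2 * (s - \<mu>) * \<mu> + (s - \<mu>)\<^sup>2"
    unfolding eq using i1 i2 L.prob_space by (simp add: \<mu>_def)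
  also have "\<dots> \<le> s\<^sup>2 + (\<integral>y. (D k (z, y))\<^sup>2 \<partial>law k)"
    by (simp add: power2_eq_square algebra_simps)
  finally have le: "(\<integral>y. (s + (D k (z, y) - \<mu>))\<^sup>2 \<partial>law k) \<le> s\<^sup>2 + (\<integral>y. (D k (z, y))\<^sup>2 \<partial>law k)" .
  have "(\<integral>\<^sup>+y. ennreal ((s + centred D k (z, y))\<^sup>2) \<partial>law k)
      = ennreal (\<integral>y. (s + (D k (z, y) - \<mu>))\<^sup>2 \<partial>law k)"
    using nn_integral_eq_integral[OF int] by (simp add: centred_def \<mu>_def)
  also have "\<dots> \<le> ennreal (s\<^sup>2) + ennreal (\<integral>y. (D k (z, y))\<^sup>2 \<partial>law k)"
    using le by (simp add: ennreal_plus[symmetric] del: ennreal_plus)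
  finally show ?thesis
    using nn_integral_eq_integral[OF i2] by simp
qed simp

text \<open>Orthogonality of martingale differences, applied to one step at a time.\<close>

lemma second_moment_bound:
  assumes D [measurable]: "\<And>k. D k \<in> borel_measurable (N \<Otimes>\<^sub>M Y)"
    and B: "\<And>k. k < n \<Longrightarrow> (\<integral>\<^sup>+\<omega>. ennreal ((D k (Z k \<omega>, e k \<omega>))\<^sup>2) \<partial>M) \<le> B"
  shows "(\<integral>\<^sup>+\<omega>. ennreal ((\<Sum>k<n. centred D k (Z k \<omega>, e k \<omega>))\<^sup>2) \<partial>M) \<le> of_nat n * B"
  using B
proof (induction n)
  case (Suc n)
  interpret L: prob_space "law n" by (rule prob_space_law)
  let ?S = "\<lambda>\<omega>. \<Sum>k<n. centred D k (Z k \<omega>, e k \<omega>)"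
  let ?\<phi> = "\<lambda>v. ennreal ((snd (fst v) + centred D n (fst (fst v), snd v))\<^sup>2)"
  have m: "?\<phi> \<in> borel_measurable ((N \<Otimes>\<^sub>M borel) \<Otimes>\<^sub>M Y)"
    by measurable
  have "(\<integral>\<^sup>+\<omega>. ennreal ((\<Sum>k<Suc n. centred D k (Z k \<omega>, e k \<omega>))\<^sup>2) \<partial>M)
      = (\<integral>\<^sup>+\<omega>. ?\<phi> ((Z n \<omega>, ?S \<omega>), e n \<omega>) \<partial>M)"
    by simp
  also have "\<dots> = (\<integral>\<^sup>+\<omega>. \<integral>\<^sup>+y. ?\<phi> ((Z n \<omega>, ?S \<omega>), y) \<partial>law n \<partial>M)"
    by (rule nn_integral_step_sum[OF _ m]) measurable
  also have "\<dots> \<le> (\<integral>\<^sup>+\<omega>. ennreal ((?S \<omega>)\<^sup>2) + (\<integral>\<^sup>+y. ennreal ((D n (Z n \<omega>, y))\<^sup>2) \<partial>law n) \<partial>M)"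
    by (intro nn_integral_mono) (auto intro!: second_moment_centred Z_space)
  also have "\<dots> = (\<integral>\<^sup>+\<omega>. ennreal ((?S \<omega>)\<^sup>2) \<partial>M)
      + (\<integral>\<^sup>+\<omega>. \<integral>\<^sup>+y. ennreal ((D n (Z n \<omega>, y))\<^sup>2) \<partial>law n \<partial>M)"
    by (rule nn_integral_add) measurable
  also have "(\<integral>\<^sup>+\<omega>. \<integral>\<^sup>+y. ennreal ((D n (Z n \<omega>, y))\<^sup>2) \<partial>law n \<partial>M)
      = (\<integral>\<^sup>+\<omega>. ennreal ((D n (Z n \<omega>, e n \<omega>))\<^sup>2) \<partial>M)"
    by (rule nn_integral_step[symmetric]) measurable
  also have "(\<integral>\<^sup>+\<omega>. ennreal ((?S \<omega>)\<^sup>2) \<partial>M) + \<dots> \<le> of_nat n * B + B"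
    using Suc by (intro add_mono) auto
  finally show ?case
    by (simp add: distrib_right add.commute)
qed simp

end

text \<open>The function \<open>r powr q * exp (- r)\<close> increases up to \<open>r = q\<close>
  and decreases afterwards, so on \<open>r \<ge> v\<close> its largest value is the one at
  \<open>w = max v q\<close>, and \<open>exp (- w) \<le> exp (- v)\<close>. In the proof this is
  \<open>ln (s / w) \<le> s / w - 1\<close> together with \<open>q / w \<le> 1\<close>.\<close>

lemma powr_le_exp_diff:
  fixes s v q :: real
  assumes "0 < v" "v \<le> s" "0 < q"
  shows "s powr q \<le> max v q powr q * exp (s - v)"
proof -
  define w where "w = max v q"
  have w: "w > 0" "v \<le> w" "q \<le> w"
    using assms by (auto simp: w_def)
  have s: "s > 0" using assms by simp
  have "q * ln (s / w) \<le> s - v"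
  proof (cases "w \<le> s")
    case True
    have "q * ln (s / w) \<le> q * (s / w - 1)"
      using s w assms by (intro mult_left_mono ln_le_minus_one) auto
    also have "\<dots> = (q / w) * (s - w)"
      using w by (simp add: field_simps)
    also have "\<dots> \<le> 1 * (s - w)"
      using w True by (intro mult_right_mono) auto
    finally show ?thesis
      using w by simp
  next
    case False
    then have "q * ln (s / w) \<le> 0"
      using s w assms by (intro mult_nonneg_nonpos) (auto simp: ln_div)
    then show ?thesis using assms by simp
  qed
  then have "(s / w) powr q \<le> exp (s - v)"
    using s w by (simp add: powr_def)
  then have "w powr q * (s / w) powr q \<le> w powr q * exp (s - v)"
    by (intro mult_left_mono) auto
  moreover have "w powr q * (s / w) powr q = s powr q"
    using s w by (simp add: powr_mult[symmetric])
  ultimately show ?thesis by (simp add: w_def)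
qed

section \<open>Truncation and the tail bound\<close>

context innovation_chain
begin

lemma prob_ge_le_exp_moment:
  assumes [measurable]: "S \<in> borel_measurable M"
    and "0 \<le> l" and le: "(\<integral>\<^sup>+\<omega>. ennreal (exp (l * S \<omega>)) \<partial>M) \<le> ennreal B" and B: "0 \<le> B"
  shows "prob {\<omega> \<in> space M. t \<le> S \<omega>} \<le> exp (- (l * t)) * B"
proof -
  have "{\<omega> \<in> space M. t \<le> S \<omega>}
      \<subseteq> {\<omega> \<in> space M. 1 \<le> ennreal (exp (- (l * t))) * ennreal (exp (l * S \<omega>))}"
    using \<open>0 \<le> l\<close> by (auto simp: ennreal_mult[symmetric] exp_add[symmetric] mult_left_mono
        simp flip: ennreal_1)
  then have "emeasure M {\<omega> \<in> space M. t \<le> S \<omega>}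
      \<le> emeasure M {\<omega> \<in> space M. 1 \<le> ennreal (exp (- (l * t))) * ennreal (exp (l * S \<omega>))}"
    by (rule emeasure_mono) measurable
  also have "\<dots> \<le> ennreal (exp (- (l * t))) * (\<integral>\<^sup>+\<omega>. ennreal (exp (l * S \<omega>)) * indicator (space M) \<omega> \<partial>M)"
    by (rule nn_integral_Markov_inequality) measurable
  also have "\<dots> \<le> ennreal (exp (- (l * t))) * ennreal B"
    using le by (intro mult_left_mono) (simp_all cong: nn_integral_cong)
  also have "\<dots> = ennreal (exp (- (l * t)) * B)"
    using B by (simp add: ennreal_mult)
  finally show ?thesis
    using B by (simp add: emeasure_eq_measure)
qed

lemma prob_ge_le_second_moment:
  assumes [measurable]: "S \<in> borel_measurable M"
    and "0 < t" and le: "(\<integral>\<^sup>+\<omega>. ennreal ((S \<omega>)\<^sup>2) \<partial>M) \<le> ennreal B" and B: "0 \<le> B"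
  shows "prob {\<omega> \<in> space M. t \<le> S \<omega>} \<le> B / t\<^sup>2"
proof -
  have "1 \<le> 1 / t\<^sup>2 * (S \<omega>)\<^sup>2" if "t \<le> S \<omega>" for \<omega>
    using that \<open>0 < t\<close> power_mono[of t "S \<omega>" 2] by (simp add: field_simps)
  then have "{\<omega> \<in> space M. t \<le> S \<omega>}
      \<subseteq> {\<omega> \<in> space M. 1 \<le> ennreal (1 / t\<^sup>2) * ennreal ((S \<omega>)\<^sup>2)}"
    by (auto simp: ennreal_mult[symmetric] simp flip: ennreal_1)
  then have "emeasure M {\<omega> \<in> space M. t \<le> S \<omega>}
      \<le> emeasure M {\<omega> \<in> space M. 1 \<le> ennreal (1 / t\<^sup>2) * ennreal ((S \<omega>)\<^sup>2)}"
    by (rule emeasure_mono) measurable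
  also have "\<dots> \<le> ennreal (1 / t\<^sup>2) * (\<integral>\<^sup>+\<omega>. ennreal ((S \<omega>)\<^sup>2) * indicator (space M) \<omega> \<partial>M)"
    by (rule nn_integral_Markov_inequality) measurable
  also have "\<dots> \<le> ennreal (1 / t\<^sup>2) * ennreal B"
    using le by (intro mult_left_mono) (simp_all cong: nn_integral_cong)
  also have "\<dots> = ennreal (B / t\<^sup>2)"
    using B by (simp add: ennreal_mult[symmetric])
  finally show ?thesis
    using B by (simp add: emeasure_eq_measure)
qed

text \<open>Half of \<open>t\<close> is spent on the part where the envelope \<open>h\<close> is at
  most \<open>u\<close> and half on the rest; this produces the 8 in the exponent and the 4 in the
  second term. The level \<open>u\<close> stays free and is chosen later.\<close>

lemma tail_bound:
  assumes D [measurable]: "\<And>k. D k \<in> borel_measurable (N \<Otimes>\<^sub>M Y)"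
    and h [measurable]: "\<And>k. h k \<in> borel_measurable (N \<Otimes>\<^sub>M Y)"
    and dom: "\<And>k \<omega> y. k < n \<Longrightarrow> \<omega> \<in> space M \<Longrightarrow> y \<in> space Y \<Longrightarrow> \<bar>D k (Z k \<omega>, y)\<bar> \<le> h k (Z k \<omega>, y)"
    and int: "\<And>k \<omega>. k < n \<Longrightarrow> \<omega> \<in> space M \<Longrightarrow> integrable (law k) (\<lambda>y. D k (Z k \<omega>, y))"
    and zero: "\<And>k \<omega>. k < n \<Longrightarrow> \<omega> \<in> space M \<Longrightarrow> (\<integral>y. D k (Z k \<omega>, y) \<partial>law k) = 0"
    and expm: "\<And>k. k < n \<Longrightarrow> (\<integral>\<^sup>+\<omega>. ennreal (exp (h k (Z k \<omega>, e k \<omega>) powr p)) \<partial>M) \<le> ennreal C1"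
    and pos: "0 < p" "0 < u" "0 < t" "0 < n" "0 \<le> C1"
  shows "prob {\<omega> \<in> space M. t \<le> (\<Sum>k<n. D k (Z k \<omega>, e k \<omega>))}
    \<le> exp (- (t\<^sup>2 / (8 * real n * u\<^sup>2)))
      + 4 * real n * C1 / t\<^sup>2 * (max (u powr p) (2 / p) powr (2 / p) * exp (- (u powr p)))"
proof -
  define D1 where "D1 k v = (if h k v \<le> u then D k v else 0)" for k v
  define D2 where "D2 k v = (if h k v \<le> u then 0 else D k v)" for k v
  have D1 [measurable]: "D1 k \<in> borel_measurable (N \<Otimes>\<^sub>M Y)" for k
    unfolding D1_def by measurable
  have D2 [measurable]: "D2 k \<in> borel_measurable (N \<Otimes>\<^sub>M Y)" for k
    unfolding D2_def by measurable
  have split: "D k (Z k \<omega>, y) = centred D1 k (Z k \<omega>, y) + centred D2 k (Z k \<omega>, y)"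
    if "k < n" "\<omega> \<in> space M" for k \<omega> y
  proof -
    interpret L: prob_space "law k" by (rule prob_space_law)
    have Zs: "Z k \<omega> \<in> space N" using that by (simp add: Z_space)
    have [measurable]: "(\<lambda>y. D1 k (Z k \<omega>, y)) \<in> borel_measurable Y" "(\<lambda>y. D2 k (Z k \<omega>, y)) \<in> borel_measurable Y"
      by (auto intro: measurable_compose[OF measurable_Pair1'[OF Zs]] D1 D2)
    have i1: "integrable (law k) (\<lambda>y. D1 k (Z k \<omega>, y))"
      by (rule Bochner_Integration.integrable_bound[OF int[OF that]], simp, simp add: D1_def)
    have i2: "integrable (law k) (\<lambda>y. D2 k (Z k \<omega>, y))"
      by (rule Bochner_Integration.integrable_bound[OF int[OF that]], simp, simp add: D2_def)
    have sum: "D k v = D1 k v + D2 k v" for v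
      by (simp add: D1_def D2_def)
    \<comment> \<open>Neither part needs to have mean 0, but \<open>D k\<close> has, so the two
      recentring terms cancel.\<close>
    have "(\<integral>y. D1 k (Z k \<omega>, y) \<partial>law k) + (\<integral>y. D2 k (Z k \<omega>, y) \<partial>law k) = 0"
      using zero[OF that] Bochner_Integration.integral_add[OF i1 i2] by (simp add: sum)
    then show ?thesis
      by (simp add: centred_def sum)
  qed
  let ?S1 = "\<lambda>\<omega>. \<Sum>k<n. centred D1 k (Z k \<omega>, e k \<omega>)"
  let ?S2 = "\<lambda>\<omega>. \<Sum>k<n. centred D2 k (Z k \<omega>, e k \<omega>)"
  have S: "(\<Sum>k<n. D k (Z k \<omega>, e k \<omega>)) = ?S1 \<omega> + ?S2 \<omega>" if "\<omega> \<in> space M" for \<omega>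
    using that by (simp add: split sum.distrib)
  have "prob {\<omega> \<in> space M. t \<le> (\<Sum>k<n. D k (Z k \<omega>, e k \<omega>))}
      \<le> prob ({\<omega> \<in> space M. t / 2 \<le> ?S1 \<omega>} \<union> {\<omega> \<in> space M. t / 2 \<le> ?S2 \<omega>})"
    by (rule finite_measure_mono) (auto simp: S)
  also have "\<dots> \<le> prob {\<omega> \<in> space M. t / 2 \<le> ?S1 \<omega>} + prob {\<omega> \<in> space M. t / 2 \<le> ?S2 \<omega>}"
    by (rule measure_Un_le) measurable
  also have "prob {\<omega> \<in> space M. t / 2 \<le> ?S1 \<omega>} \<le> exp (- (t\<^sup>2 / (8 * real n * u\<^sup>2)))"
  proof -
    \<comment> \<open>The minimizer of \<open>- l * (t / 2) + n * l^2 * u^2 / 2\<close>.\<close>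
    define l where "l = t / (2 * real n * u\<^sup>2)"
    have l: "l > 0" using pos by (simp add: l_def)
    have bound: "\<bar>D1 k (Z k \<omega>, y)\<bar> \<le> u" if "k < n" "\<omega> \<in> space M" "y \<in> space Y" for k \<omega> y
      using dom[OF that] pos by (auto simp: D1_def)
    have "prob {\<omega> \<in> space M. t / 2 \<le> ?S1 \<omega>} \<le> exp (- (l * (t / 2))) * exp (real n * (l\<^sup>2 * u\<^sup>2 / 2))"
      by (rule prob_ge_le_exp_moment[OF _ _ exp_moment_bound[OF D1 bound l]]) (use l in auto)
    also have "\<dots> = exp (- (t\<^sup>2 / (8 * real n * u\<^sup>2)))"
      using pos unfolding exp_add[symmetric] l_def by (simp add: field_simps power2_eq_square)
    finally show ?thesis .
  qed
  also have "prob {\<omega> \<in> space M. t / 2 \<le> ?S2 \<omega>}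
      \<le> 4 * real n * C1 / t\<^sup>2 * (max (u powr p) (2 / p) powr (2 / p) * exp (- (u powr p)))"
  proof -
    define K where "K = max (u powr p) (2 / p) powr (2 / p) * exp (- (u powr p))"
    have K: "K \<ge> 0" by (simp add: K_def)
    \<comment> \<open>Where \<open>h\<close> exceeds \<open>u\<close>, write the square of the
      envelope as \<open>(h powr p) powr (2 / p)\<close> and apply \<open>powr_le_exp_diff\<close>
      with \<open>v = u powr p\<close>: this splits off \<open>exp (- (u powr p))\<close> and leaves
      the exponential whose mean is controlled.\<close>
    have pt: "(D2 k (Z k \<omega>, e k \<omega>))\<^sup>2 \<le> K * exp (h k (Z k \<omega>, e k \<omega>) powr p)"
      if "k < n" "\<omega> \<in> space M" for k \<omega>
    proof (cases "h k (Z k \<omega>, e k \<omega>) \<le> u")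
      case True
      then show ?thesis using K by (simp add: D2_def)
    next
      case False
      define H where "H = h k (Z k \<omega>, e k \<omega>)"
      have H: "u < H" using False by (simp add: H_def)
      have "e k \<omega> \<in> space Y" using that e_measurable by (metis measurable_space)
      then have "\<bar>D2 k (Z k \<omega>, e k \<omega>)\<bar> \<le> H"
        using dom[OF that] False by (simp add: D2_def H_def)
      then have "(D2 k (Z k \<omega>, e k \<omega>))\<^sup>2 \<le> H\<^sup>2"
        using H pos by (simp add: abs_le_square_iff[symmetric])
      also have "H\<^sup>2 = (H powr p) powr (2 / p)"
        using H pos by (simp add: powr_powr)
      also have "\<dots> \<le> max (u powr p) (2 / p) powr (2 / p) * exp (H powr p - u powr p)"
        using H pos by (intro powr_le_exp_diff) (auto intro!: powr_mono2)
      also have "\<dots> = K * exp (H powr p)"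
        by (simp add: K_def exp_diff exp_minus field_simps)
      finally show ?thesis by (simp add: H_def)
    qed
    have "(\<integral>\<^sup>+\<omega>. ennreal ((D2 k (Z k \<omega>, e k \<omega>))\<^sup>2) \<partial>M) \<le> ennreal (K * C1)" if "k < n" for k
    proof -
      have "(\<integral>\<^sup>+\<omega>. ennreal ((D2 k (Z k \<omega>, e k \<omega>))\<^sup>2) \<partial>M)
          \<le> (\<integral>\<^sup>+\<omega>. ennreal K * ennreal (exp (h k (Z k \<omega>, e k \<omega>) powr p)) \<partial>M)"
        using pt[OF that] K by (intro nn_integral_mono) (auto simp: ennreal_mult[symmetric] intro!: ennreal_leI)
      also have "\<dots> = ennreal K * (\<integral>\<^sup>+\<omega>. ennreal (exp (h k (Z k \<omega>, e k \<omega>) powr p)) \<partial>M)"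
        by (rule nn_integral_cmult) measurable
      also have "\<dots> \<le> ennreal K * ennreal C1"
        by (rule mult_left_mono[OF expm[OF that]]) simp
      finally show ?thesis using K pos by (simp add: ennreal_mult)
    qed
    from second_moment_bound[OF D2 this]
    have "(\<integral>\<^sup>+\<omega>. ennreal ((?S2 \<omega>)\<^sup>2) \<partial>M) \<le> ennreal (real n * (K * C1))"
      using K pos by (simp add: ennreal_mult ennreal_of_nat_eq_real_of_nat)
    then have "prob {\<omega> \<in> space M. t / 2 \<le> ?S2 \<omega>} \<le> (real n * (K * C1)) / (t / 2)\<^sup>2"
      using K pos by (intro prob_ge_le_second_moment) auto
    also have "\<dots> = 4 * real n * C1 / t\<^sup>2 * K"
      by (simp add: power2_eq_square)
    finally show ?thesis by (simp add: K_def)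
  qed
  finally show ?thesis by simp
qed

end

section \<open>The numbers a_k(k): renewal equation and monotonicity\<close>

lemma adiag_eq_sum: "adiag a k = 1 + (\<Sum>l<k. adiag a l * a (k - l))"
proof (cases k)
  case (Suc m)
  \<comment> \<open>The separate summand \<open>a (Suc m)\<close> of the recursion is the term
    \<open>l = 0\<close>, because \<open>adiag a 0 = 1\<close>.\<close>
  have "(\<Sum>l<Suc m. adiag a l * a (Suc m - l)) = a (Suc m) + (\<Sum>l<m. adiag a (Suc l) * a (Suc m - Suc l))"
    by (subst sum.lessThan_Suc_shift) simp
  also have "(\<Sum>l<m. adiag a (Suc l) * a (Suc m - Suc l)) = (\<Sum>l=1..m. adiag a l * a (Suc m - l))"
    using sum.atLeast1_atMost_eq[of "\<lambda>l. adiag a l * a (Suc m - l)" m] by simp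
  finally show ?thesis
    by (simp add: Suc)
qed simp

lemma adiag_eq_sum_rev: "adiag a k = 1 + (\<Sum>i<k. adiag a (k - Suc i) * a (Suc i))"
proof -
  have "(\<Sum>l<k. adiag a l * a (k - l)) = (\<Sum>i<k. adiag a (k - Suc i) * a (k - (k - Suc i)))"
    by (rule sum.nat_diff_reindex[symmetric])
  also have "\<dots> = (\<Sum>i<k. adiag a (k - Suc i) * a (Suc i))"
    by (intro sum.cong) (auto simp: Suc_diff_Suc)
  finally show ?thesis
    using adiag_eq_sum[of a k] by simp
qed

context
  fixes a :: "nat \<Rightarrow> real"
  assumes a_nonneg: "\<And>i. i \<ge> 1 \<Longrightarrow> a i \<ge> 0"
begin

lemma adiag_ge_1: "1 \<le> adiag a k"
proof (induction k rule: less_induct)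
  case (less k)
  have "0 \<le> adiag a l * a (k - l)" if "l < k" for l
    using less[OF that] a_nonneg[of "k - l"] that by simp
  then show ?case
    by (subst adiag_eq_sum) (auto intro!: sum_nonneg)
qed

text \<open>In the reversed sum the weights \<open>a (Suc i)\<close> stay fixed: going from
  \<open>k\<close> to \<open>Suc k\<close> raises each factor by induction and appends a nonnegative
  term. Monotonicity lets a_{n-1}(n-1) serve as the constant for all times.\<close>

lemma adiag_le_Suc: "adiag a k \<le> adiag a (Suc k)"
proof (induction k rule: less_induct)
  case (less k)
  have ge: "adiag a l \<ge> 0" for l
    using adiag_ge_1[of l] by simp
  have "adiag a k = 1 + (\<Sum>i<k. adiag a (k - Suc i) * a (Suc i))"
    by (rule adiag_eq_sum_rev)
  also have "\<dots> \<le> 1 + (\<Sum>i<k. adiag a (k - i) * a (Suc i))"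
  proof (intro add_left_mono sum_mono mult_right_mono)
    fix i assume "i \<in> {..<k}"
    then show "adiag a (k - Suc i) \<le> adiag a (k - i)"
      using less[of "k - Suc i"] by (simp add: Suc_diff_Suc)
  qed (use a_nonneg in auto)
  also have "\<dots> \<le> 1 + (\<Sum>i<Suc k. adiag a (k - i) * a (Suc i))"
    using ge a_nonneg by simp
  also have "\<dots> = adiag a (Suc k)"
    by (subst adiag_eq_sum_rev) simp
  finally show ?case .
qed

lemma adiag_mono: "k \<le> l \<Longrightarrow> adiag a k \<le> adiag a l"
  by (rule lift_Suc_mono_le[of "adiag a"]) (rule adiag_le_Suc)

end

text \<open>
  With \<open>b = y sqrt(n) / 8\<close> the truncation level is \<open>b powr (1 - \<alpha>)\<close>, so that its power
  \<open>2 \<alpha> / (1 - \<alpha>)\<close> is the target exponent \<open>w = b powr (2 \<alpha>)\<close>.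
\<close>

lemma tail_constants:
  fixes \<alpha> y \<nu> C1 :: real
  assumes \<alpha>: "0 < \<alpha>" "\<alpha> < 1" and y: "0 < y" and \<nu>: "1 \<le> \<nu>" and C1: "0 \<le> C1"
  defines "p \<equiv> 2 * \<alpha> / (1 - \<alpha>)" and "u \<equiv> (y * sqrt \<nu> / 8) powr (1 - \<alpha>)"
    and "w \<equiv> (y / 8) powr (2 * \<alpha>) * \<nu> powr \<alpha>"
  shows "exp (- ((\<nu> * y)\<^sup>2 / (8 * \<nu> * u\<^sup>2)))
      + 4 * \<nu> * C1 / (\<nu> * y)\<^sup>2 * (max (u powr p) (2 / p) powr (2 / p) * exp (- (u powr p)))
    \<le> (2 + 35 * C1 * (1 / (y powr (2 * \<alpha>) * 4 powr (2 - 3 * \<alpha>))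
          + 4 / y\<^sup>2 * (3 * (1 - \<alpha>) / (2 * \<alpha>)) powr ((1 - \<alpha>) / \<alpha>))) * exp (- w)"
proof -
  define b where "b = y * sqrt \<nu> / 8"
  define q where "q = (1 - \<alpha>) / \<alpha>"
  have b: "b > 0" using y \<nu> by (simp add: b_def)
  have q: "q > 0" "2 / p = q" using \<alpha> by (auto simp: q_def p_def field_simps)
  have w: "w = b powr (2 * \<alpha>)"
  proof -
    have "b powr (2 * \<alpha>) = (y / 8) powr (2 * \<alpha>) * sqrt \<nu> powr (2 * \<alpha>)"
      using y \<nu> by (simp add: b_def powr_mult[symmetric])
    also have "sqrt \<nu> powr (2 * \<alpha>) = \<nu> powr \<alpha>"
      using \<nu> by (simp add: powr_half_sqrt[symmetric] powr_powr)
    finally show ?thesis by (simp add: w_def)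
  qed
  have w0: "w > 0" using b by (simp add: w)
  have up: "u powr p = w"
    using \<alpha> by (simp add: u_def p_def w b_def powr_powr)
  have u2: "u\<^sup>2 = b powr (2 - 2 * \<alpha>)"
    using b by (simp add: u_def b_def[symmetric] power2_eq_square powr_add[symmetric])
  have b2: "\<nu> * y\<^sup>2 = 64 * b\<^sup>2"
    using \<nu> by (simp add: b_def power_mult_distrib power_divide)
  have bb: "b\<^sup>2 = b powr (2 * \<alpha>) * b powr (2 - 2 * \<alpha>)"
    using b by (simp add: powr_add[symmetric])
  have "(\<nu> * y)\<^sup>2 / (8 * \<nu> * u\<^sup>2) = (\<nu> * y\<^sup>2) / (8 * u\<^sup>2)"
    using \<nu> by (simp add: power2_eq_square)
  also have "\<dots> = 8 * w"
    using b by (simp add: b2 u2 bb w)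
  finally have 1: "exp (- ((\<nu> * y)\<^sup>2 / (8 * \<nu> * u\<^sup>2))) \<le> exp (- w)"
    using w0 by simp
  define c1 where "c1 = 1 / (y powr (2 * \<alpha>) * 4 powr (2 - 3 * \<alpha>))"
  define c2 where "c2 = 4 / y\<^sup>2 * (3 * (1 - \<alpha>) / (2 * \<alpha>)) powr q"
  have c: "c1 \<ge> 0" "c2 \<ge> 0" by (auto simp: c1_def c2_def)
  \<comment> \<open>Bounding the maximum by the sum separates the two summands of the constant:
    \<open>w powr q\<close> leads to \<open>c1\<close>, and \<open>q powr q\<close> to
    \<open>c2\<close>.\<close>
  have "4 / (\<nu> * y\<^sup>2) * max w q powr q \<le> 4 / (\<nu> * y\<^sup>2) * (w powr q + q powr q)"
    using \<nu> by (intro mult_left_mono) (auto simp: max_def)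
  also have "\<dots> = 4 / (\<nu> * y\<^sup>2) * w powr q + 4 / (\<nu> * y\<^sup>2) * q powr q"
    by (simp add: distrib_left)
  also have "4 / (\<nu> * y\<^sup>2) * w powr q = 1 / (16 * w)"
  proof -
    have "w powr q = b powr (2 - 2 * \<alpha>)"
    proof -
      have "2 * \<alpha> * q = 2 - 2 * \<alpha>"
        using \<alpha> by (simp add: q_def field_simps)
      then show ?thesis by (simp add: w powr_powr)
    qed
    then show ?thesis
      using b by (simp add: b2 bb w)
  qed
  also have "1 / (16 * w) \<le> c1"
  proof -
    have "1 * 1 \<le> \<nu> powr \<alpha> * 1"
      using \<nu> \<alpha> by (simp add: ge_one_powr_ge_zero)
    then have "16 * (y / 8) powr (2 * \<alpha>) \<le> 16 * w"
      using mult_left_mono[of 1 "\<nu> powr \<alpha>" "(y / 8) powr (2 * \<alpha>)"] by (simp add: w_def)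
    \<comment> \<open>The factor \<open>4 powr (2 - 3 * \<alpha>)\<close> is 16 divided by
      \<open>8 powr (2 * \<alpha>)\<close>.\<close>
    moreover have "16 * (y / 8) powr (2 * \<alpha>) = y powr (2 * \<alpha>) * 4 powr (2 - 3 * \<alpha>)"
    proof -
      have "(8::real) = 4 powr (3 / 2)"
        using powr_half_sqrt[of "4::real"] powr_add[of "4::real" 1 "1/2"] by simp
      then have "(8::real) powr (2 * \<alpha>) = (4 powr (3 / 2)) powr (2 * \<alpha>)"
        by (rule arg_cong)
      also have "\<dots> = 4 powr (3 / 2 * (2 * \<alpha>))"
        by (rule powr_powr)
      also have "3 / 2 * (2 * \<alpha>) = 3 * \<alpha>"
        by simp
      finally have "(8::real) powr (2 * \<alpha>) = 4 powr (3 * \<alpha>)" .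
      moreover have "(4::real) powr (2 - 3 * \<alpha>) = 16 / 4 powr (3 * \<alpha>)"
        by (simp add: powr_diff)
      ultimately show ?thesis
        using y by (simp add: powr_divide)
    qed
    ultimately show ?thesis
      using y unfolding c1_def by (intro divide_left_mono) (auto simp: w0)
  qed
  also have "4 / (\<nu> * y\<^sup>2) * q powr q \<le> c2"
    unfolding c2_def
  proof (rule mult_mono)
    show "4 / (\<nu> * y\<^sup>2) \<le> 4 / y\<^sup>2"
      using \<nu> y by (intro divide_left_mono) auto
    show "q powr q \<le> (3 * (1 - \<alpha>) / (2 * \<alpha>)) powr q"
      using q \<alpha> by (intro powr_mono2) (auto simp: q_def field_simps)
  qed auto
  finally have "4 / (\<nu> * y\<^sup>2) * max w q powr q \<le> c1 + c2"
    by simp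
  then have "C1 * exp (- w) * (4 / (\<nu> * y\<^sup>2) * max w q powr q) \<le> C1 * exp (- w) * (c1 + c2)"
    using C1 by (intro mult_left_mono) auto
  moreover have "4 * \<nu> * C1 / (\<nu> * y)\<^sup>2 * (max w q powr q * exp (- w))
      = C1 * exp (- w) * (4 / (\<nu> * y\<^sup>2) * max w q powr q)"
    using \<nu> by (simp add: power2_eq_square mult_ac)
  ultimately have "4 * \<nu> * C1 / (\<nu> * y)\<^sup>2 * (max w q powr q * exp (- w)) \<le> C1 * (c1 + c2) * exp (- w)"
    by (simp add: mult_ac)
  moreover have "C1 * (c1 + c2) * exp (- w) \<le> 35 * C1 * (c1 + c2) * exp (- w)"
    using C1 c by (intro mult_right_mono) auto
  ultimately have "exp (- ((\<nu> * y)\<^sup>2 / (8 * \<nu> * u\<^sup>2)))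
      + 4 * \<nu> * C1 / (\<nu> * y)\<^sup>2 * (max w q powr q * exp (- w))
      \<le> 2 * exp (- w) + 35 * C1 * (c1 + c2) * exp (- w)"
    using 1 exp_ge_zero[of "- w"] by linarith
  then show ?thesis
    unfolding up q(2) c1_def c2_def q_def by (simp add: distrib_right)
qed

lemma lipschitz_measurable_PiM:
  fixes f :: "(nat \<Rightarrow> 'x::polish_space) \<Rightarrow> real"
  assumes f: "\<And>u v. \<bar>f u - f v\<bar> \<le> (\<Sum>i=1..n. dist (u i) (v i))"
  shows "f \<in> borel_measurable (\<Pi>\<^sub>M j\<in>UNIV. borel)"
proof -
  \<comment> \<open>Continuity for the product topology suffices: with countably many second
    countable factors, the product sigma-algebra is the Borel one.\<close>
  have "isCont f u" for u
  proof -
    have "((\<lambda>v. v i) \<longlongrightarrow> u i) (at u)" for i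
    proof -
      have "continuous_on UNIV (\<lambda>v::nat \<Rightarrow> 'x. v i)"
        by (rule continuous_on_product_coordinates)
      then have "isCont (\<lambda>v. v i) u"
        using continuous_on_eq_continuous_at[OF open_UNIV, of "\<lambda>v::nat \<Rightarrow> 'x. v i"] by blast
      then show ?thesis
        by (rule isContD)
    qed
    then have "((\<lambda>v. \<Sum>i=1..n. dist (v i) (u i)) \<longlongrightarrow> (\<Sum>i=1..n. dist (u i) (u i))) (at u)"
      by (intro tendsto_sum tendsto_dist tendsto_const)
    then have "((\<lambda>v. \<Sum>i=1..n. dist (v i) (u i)) \<longlongrightarrow> 0) (at u)"
      by simp
    then have "((\<lambda>v. f v - f u) \<longlongrightarrow> 0) (at u)"
      by (rule Lim_null_comparison[rotated]) (use f in auto)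
    then show ?thesis
      by (simp add: isCont_def LIM_zero_iff)
  qed
  then have "continuous_on UNIV f"
    by (simp add: continuous_on_eq_continuous_at)
  then have "f \<in> borel_measurable borel"
    by (rule borel_measurable_continuous_onI)
  then show ?thesis
    using sets_PiM_equal_borel measurable_cong_sets by blast
qed

lemma exp_powr_measurable [measurable]: "exp_powr p \<in> borel_measurable borel"
  unfolding exp_powr_def by measurable

text \<open>The exponential of any positive power outgrows the identity, so the exponential moment
  also bounds the mean. A positive \<open>K\<close> covers \<open>h = \<top>\<close>, where both
  sides are infinite.\<close>

lemma le_exp_powr:
  assumes p: "p > 0"
  shows "\<exists>K\<ge>0. \<forall>h. h \<le> ennreal K * exp_powr p h"
proof -
  define K where "K = 1 + max 1 (1 / p) powr (1 / p)"
  have K: "K \<ge> 1" by (simp add: K_def)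
  have real_le: "r \<le> K * exp (r powr p)" if r: "r \<ge> 0" for r
  proof (cases "r \<le> 1")
    case True
    have "1 * 1 \<le> K * exp (r powr p)"
      using K by (intro mult_mono) auto
    then show ?thesis using True by simp
  next
    case False
    then have "r = (r powr p) powr (1 / p)"
      using p by (simp add: powr_powr)
    also have "\<dots> \<le> max 1 (1 / p) powr (1 / p) * exp (r powr p - 1)"
      using False p by (intro powr_le_exp_diff) (auto simp: ge_one_powr_ge_zero)
    also have "\<dots> \<le> K * exp (r powr p)"
      by (intro mult_mono) (auto simp: K_def)
    finally show ?thesis .
  qed
  have "h \<le> ennreal K * exp_powr p h" for h
  proof (cases h)
    case (real r)
    then show ?thesis
      using real_le[of r] K by (simp add: exp_powr_def ennreal_mult[symmetric] ennreal_leI)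
  next
    case top
    then show ?thesis using K by (simp add: exp_powr_def ennreal_mult_top)
  qed
  then show ?thesis using K by (intro exI[of _ K]) auto
qed

section \<open>The recursion as a chain of sequences\<close>

locale contracting_recursion = prob_space M for M :: "'w measure" +
  fixes eps :: "nat \<Rightarrow> 'w \<Rightarrow> 'y::polish_space"
    and X :: "int \<Rightarrow> 'w \<Rightarrow> 'x::polish_space"
    and x0 :: "int \<Rightarrow> 'x"
    and F :: "nat \<Rightarrow> (nat \<Rightarrow> 'x) \<Rightarrow> 'y \<Rightarrow> 'x"
    and a :: "nat \<Rightarrow> real"
    and f :: "(nat \<Rightarrow> 'x) \<Rightarrow> real"
    and n :: nat
    and p C1 :: real
  assumes indep_eps: "indep_vars (\<lambda>_. borel) eps {1..}"
    and F_measurable: "\<And>m. m \<ge> 1 \<Longrightarrow> (\<lambda>(z, y). F m z y) \<in> (\<Pi>\<^sub>M j\<in>UNIV. borel) \<Otimes>\<^sub>M borel \<rightarrow>\<^sub>M borel"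
    and X_nonpos: "\<And>i \<omega>. i \<le> 0 \<Longrightarrow> \<omega> \<in> space M \<Longrightarrow> X i \<omega> = x0 i"
    and X_pos: "\<And>m \<omega>. m \<ge> 1 \<Longrightarrow> \<omega> \<in> space M \<Longrightarrow> X (int m) \<omega> = F m (past X m \<omega>) (eps m \<omega>)"
    and a_nonneg: "\<And>i. i \<ge> 1 \<Longrightarrow> a i \<ge> 0"
    and contraction: "\<And>m z z'. m \<ge> 1 \<Longrightarrow>
           (\<integral>\<^sup>+\<omega>. ennreal (dist (F m z (eps m \<omega>)) (F m z' (eps m \<omega>))) \<partial>M)
             \<le> (\<Sum>j. ennreal (a (Suc j) * dist (z j) (z' j)))"
    and f_lipschitz: "\<And>u v. \<bar>f u - f v\<bar> \<le> (\<Sum>i=1..n. dist (u i) (v i))"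
    and p_pos: "p > 0"
    and exp_moment: "\<And>k. 1 \<le> k \<Longrightarrow> k \<le> n \<Longrightarrow>
           (\<integral>\<^sup>+\<omega>. exp_powr p (Hfun (distr M borel (eps k)) (F k) (past X k \<omega>) (eps k \<omega>)) \<partial>M)
             \<le> ennreal C1"
begin

abbreviation N :: "(nat \<Rightarrow> 'x) measure" where
  "N \<equiv> \<Pi>\<^sub>M j\<in>UNIV. borel"

abbreviation P :: "nat \<Rightarrow> 'y measure" where
  "P k \<equiv> distr M borel (eps (Suc k))"

definition step :: "nat \<Rightarrow> (nat \<Rightarrow> 'x) \<Rightarrow> 'y \<Rightarrow> nat \<Rightarrow> 'x" where
  "step k z y = case_nat (F (Suc k) z y) z"

text \<open>Entry 0 is X_k. Hence \<open>state 0\<close> is the prescribed past, and the step from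
  \<open>k\<close> to \<open>Suc k\<close> uses \<open>F (Suc k)\<close> and
  \<open>eps (Suc k)\<close>: innovations counted from 1 drive a chain counted from 0.\<close>

definition state :: "nat \<Rightarrow> 'w \<Rightarrow> nat \<Rightarrow> 'x" where
  "state k = past X (Suc k)"

definition init :: "nat \<Rightarrow> 'x" where
  "init j = x0 (- int j)"

text \<open>The sequences that a state at time \<open>k\<close> can be: those ending in the prescribed past.\<close>

definition histories :: "nat \<Rightarrow> (nat \<Rightarrow> 'x) set" where
  "histories k = {z. \<forall>j\<ge>k. z j = x0 (int k - int j)}"

lemma space_N [simp]: "space N = UNIV"
  by (simp add: space_PiM)

lemma eps_measurable [measurable]: "eps (Suc k) \<in> borel_measurable M"
  using indep_eps by (auto simp: indep_vars_def)

lemma prob_space_P: "prob_space (P k)"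
  by (rule prob_space_distr) simp

lemma step_measurable: "(\<lambda>(z, y). step k z y) \<in> N \<Otimes>\<^sub>M borel \<rightarrow>\<^sub>M N"
proof (rule measurable_PiM_single')
  fix j :: nat
  have F: "(\<lambda>v. F (Suc k) (fst v) (snd v)) \<in> borel_measurable (N \<Otimes>\<^sub>M borel)"
    using F_measurable[of "Suc k"] by (simp add: split_beta)
  have z: "(\<lambda>v. fst v i) \<in> borel_measurable (N \<Otimes>\<^sub>M borel)" for i :: nat
    by (rule measurable_compose[OF measurable_fst measurable_component_singleton]) simp
  show "(\<lambda>v. (case v of (z, y) \<Rightarrow> step k z y) j) \<in> borel_measurable (N \<Otimes>\<^sub>M borel)"
    using F z by (cases j) (simp_all add: step_def split_beta)
qed auto

lemma F_measurable_snd [measurable]: "F (Suc k) z \<in> borel_measurable borel"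
  using measurable_compose[OF measurable_Pair1'[of z N borel] F_measurable[of "Suc k"]] by simp

lemma state_0: "\<omega> \<in> space M \<Longrightarrow> state 0 \<omega> = init"
  by (auto simp: state_def past_def init_def X_nonpos)

lemma state_Suc:
  assumes "\<omega> \<in> space M"
  shows "state (Suc k) \<omega> = step k (state k \<omega>) (eps (Suc k) \<omega>)"
proof
  fix j
  show "state (Suc k) \<omega> j = step k (state k \<omega>) (eps (Suc k) \<omega>) j"
    using X_pos[of "Suc k" \<omega>] assms
    by (cases j) (auto simp: state_def step_def past_def algebra_simps)
qed

lemma chain: "innovation_chain M borel (\<lambda>k. eps (Suc k)) N step state init"
proof
  \<comment> \<open>The shift of the index is done by grouping the family into the singleton blocks
    \<open>{Suc j}\<close> and reading off their only coordinate.\<close>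
  have "indep_vars (\<lambda>j. PiM {Suc j} (\<lambda>_. borel)) (\<lambda>j \<omega>. restrict (\<lambda>i. eps i \<omega>) {Suc j}) UNIV"
    by (rule indep_vars_restrict[OF indep_eps]) (auto simp: disjoint_family_on_def)
  from indep_vars_compose2[OF this, of "\<lambda>j w. w (Suc j)" "\<lambda>_. borel"]
  show "indep_vars (\<lambda>_. borel) (\<lambda>k. eps (Suc k)) UNIV"
    by simp
qed (simp_all add: step_measurable state_0 state_Suc)

lemma Hfun_measurable [measurable]:
  "(\<lambda>v. Hfun (P k) (F (Suc k)) (fst v) (snd v)) \<in> borel_measurable (N \<Otimes>\<^sub>M borel)"
proof -
  interpret L: prob_space "P k" by (rule prob_space_P)
  have [measurable]: "(\<lambda>v. F (Suc k) (fst v) (snd v)) \<in> borel_measurable (N \<Otimes>\<^sub>M borel)"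
    using F_measurable[of "Suc k"] by (simp add: split_beta)
  have [measurable]: "(\<lambda>v. F (Suc k) (fst (fst v)) (snd v)) \<in> borel_measurable ((N \<Otimes>\<^sub>M borel) \<Otimes>\<^sub>M borel)"
    by (rule measurable_compose[of "\<lambda>v. (fst (fst v), snd v)" _ "N \<Otimes>\<^sub>M borel"
          "\<lambda>v. F (Suc k) (fst v) (snd v)", simplified]) measurable
  have [measurable]: "(\<lambda>v. F (Suc k) (fst (fst v)) (snd (fst v))) \<in> borel_measurable ((N \<Otimes>\<^sub>M borel) \<Otimes>\<^sub>M borel)"
    by (rule measurable_compose[of fst _ "N \<Otimes>\<^sub>M borel"]) measurable
  have "(\<lambda>(v, y). ennreal (dist (F (Suc k) (fst v) (snd v)) (F (Suc k) (fst v) y)))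
      \<in> borel_measurable ((N \<Otimes>\<^sub>M borel) \<Otimes>\<^sub>M borel)"
    unfolding split_beta by measurable
  then have "(\<lambda>(v, y). ennreal (dist (F (Suc k) (fst v) (snd v)) (F (Suc k) (fst v) y)))
      \<in> borel_measurable ((N \<Otimes>\<^sub>M borel) \<Otimes>\<^sub>M P k)"
    by (subst measurable_cong_sets[OF sets_pair_measure_cong[OF refl sets_distr] refl])
  then show ?thesis
    unfolding Hfun_def by (rule L.borel_measurable_nn_integral)
qed

text \<open>The starting point of the integrability argument: \<open>h\<close> is at most a multiple
  of \<open>exp_powr p h\<close>.\<close>

lemma H_integrable:
  assumes "k < n"
  shows "(\<integral>\<^sup>+\<omega>. Hfun (P k) (F (Suc k)) (state k \<omega>) (eps (Suc k) \<omega>) \<partial>M) < \<top>"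
proof -
  interpret C: innovation_chain M borel "\<lambda>k. eps (Suc k)" N step state init
    by (rule chain)
  obtain K where K: "0 \<le> K" "\<And>h. h \<le> ennreal K * exp_powr p h"
    using le_exp_powr[OF p_pos] by blast
  have "(\<lambda>\<omega>. (state k \<omega>, eps (Suc k) \<omega>)) \<in> M \<rightarrow>\<^sub>M N \<Otimes>\<^sub>M borel"
    by measurable
  from measurable_compose[OF this Hfun_measurable[of k]]
  have m: "(\<lambda>\<omega>. exp_powr p (Hfun (P k) (F (Suc k)) (state k \<omega>) (eps (Suc k) \<omega>))) \<in> borel_measurable M"
    by (intro measurable_compose[OF _ exp_powr_measurable]) simp
  have "(\<integral>\<^sup>+\<omega>. Hfun (P k) (F (Suc k)) (state k \<omega>) (eps (Suc k) \<omega>) \<partial>M)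
      \<le> (\<integral>\<^sup>+\<omega>. ennreal K * exp_powr p (Hfun (P k) (F (Suc k)) (state k \<omega>) (eps (Suc k) \<omega>)) \<partial>M)"
    by (intro nn_integral_mono K)
  also have "\<dots> = ennreal K * (\<integral>\<^sup>+\<omega>. exp_powr p (Hfun (P k) (F (Suc k)) (state k \<omega>) (eps (Suc k) \<omega>)) \<partial>M)"
    by (rule nn_integral_cmult[OF m])
  also have "\<dots> \<le> ennreal K * ennreal C1"
    using exp_moment[of "Suc k"] assms by (intro mult_left_mono) (auto simp: state_def)
  also have "\<dots> < \<top>"
    by (simp add: ennreal_mult_less_top)
  finally show ?thesis .
qed

section \<open>Contraction and integrability on histories\<close>

lemma state_histories: "\<omega> \<in> space M \<Longrightarrow> state k \<omega> \<in> histories k"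
  by (auto simp: histories_def state_def past_def X_nonpos)

lemma step_histories:
  assumes "z \<in> histories k"
  shows "step k z y \<in> histories (Suc k)"
  unfolding histories_def
proof (intro CollectI allI impI)
  fix j assume "Suc k \<le> j"
  then show "step k z y j = x0 (int (Suc k) - int j)"
    using assms by (cases j) (auto simp: histories_def step_def)
qed

text \<open>Two histories at time \<open>k\<close> agree from index \<open>k\<close> on, so only
  \<open>k\<close> terms of the contraction series survive and its value is finite. For arbitrary
  sequences it may diverge.\<close>

lemma nn_integral_dist_F_le:
  assumes z: "z \<in> histories k" and z': "z' \<in> histories k"
  shows "(\<integral>\<^sup>+y. ennreal (dist (F (Suc k) z y) (F (Suc k) z' y)) \<partial>P k)
    \<le> ennreal (\<Sum>j<k. a (Suc j) * dist (z j) (z' j))"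
proof -
  have "(\<integral>\<^sup>+y. ennreal (dist (F (Suc k) z y) (F (Suc k) z' y)) \<partial>P k)
      = (\<integral>\<^sup>+\<omega>. ennreal (dist (F (Suc k) z (eps (Suc k) \<omega>)) (F (Suc k) z' (eps (Suc k) \<omega>))) \<partial>M)"
    by (rule nn_integral_distr) measurable
  also have "\<dots> \<le> (\<Sum>j. ennreal (a (Suc j) * dist (z j) (z' j)))"
    by (rule contraction) simp
  also have "\<dots> = (\<Sum>j<k. ennreal (a (Suc j) * dist (z j) (z' j)))"
    by (rule suminf_finite) (use z z' in \<open>auto simp: histories_def\<close>)
  also have "\<dots> = ennreal (\<Sum>j<k. a (Suc j) * dist (z j) (z' j))"
    by (rule sum_ennreal) (use a_nonneg in auto)
  finally show ?thesis .
qed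

lemma integrable_dist_F:
  assumes "z \<in> histories k" "z' \<in> histories k"
  shows "integrable (P k) (\<lambda>y. dist (F (Suc k) z y) (F (Suc k) z' y))"
  using le_less_trans[OF nn_integral_dist_F_le[OF assms] ennreal_less_top]
  by (intro integrableI_nonneg) auto

lemma integral_dist_F_le:
  assumes "z \<in> histories k" "z' \<in> histories k"
  shows "(\<integral>y. dist (F (Suc k) z y) (F (Suc k) z' y) \<partial>P k) \<le> (\<Sum>j<k. a (Suc j) * dist (z j) (z' j))"
proof -
  have "0 \<le> (\<Sum>j<k. a (Suc j) * dist (z j) (z' j))"
    by (intro sum_nonneg) (use a_nonneg in auto)
  then show ?thesis
    using nn_integral_dist_F_le[OF assms] nn_integral_eq_integral[OF integrable_dist_F[OF assms]] by simp
qed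

text \<open>
  One history with an integrable distance is supplied by the finiteness of the expectation of \<open>H\<close>;
  the contraction property transfers it to all others.
\<close>

lemma integrable_dist_F_const:
  assumes z: "z \<in> histories k" and k: "k < n"
  shows "integrable (P k) (\<lambda>y. dist (F (Suc k) z y) c)"
proof -
  interpret C: innovation_chain M borel "\<lambda>k. eps (Suc k)" N step state init
    by (rule chain)
  interpret L: prob_space "P k" by (rule prob_space_P)
  \<comment> \<open>On a probability space a function that is infinite everywhere has infinite
    mean.\<close>
  have "\<exists>\<omega>\<in>space M. Hfun (P k) (F (Suc k)) (state k \<omega>) (eps (Suc k) \<omega>) < \<top>"
  proof (rule ccontr)
    assume "\<not> ?thesis"
    then have "Hfun (P k) (F (Suc k)) (state k \<omega>) (eps (Suc k) \<omega>) = \<top>" if "\<omega> \<in> space M" for \<omega>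
      using that by (auto simp: less_top[symmetric])
    then have "(\<integral>\<^sup>+\<omega>. Hfun (P k) (F (Suc k)) (state k \<omega>) (eps (Suc k) \<omega>) \<partial>M) = (\<integral>\<^sup>+\<omega>. \<top> \<partial>M)"
      by (rule nn_integral_cong)
    then show False
      using H_integrable[OF k] by (simp add: emeasure_space_1)
  qed
  then obtain \<omega> where \<omega>: "\<omega> \<in> space M"
    and fin: "Hfun (P k) (F (Suc k)) (state k \<omega>) (eps (Suc k) \<omega>) < \<top>"
    by blast
  define z1 where "z1 = state k \<omega>"
  define c1 where "c1 = F (Suc k) z1 (eps (Suc k) \<omega>)"
  have z1: "z1 \<in> histories k" using \<omega> by (simp add: z1_def state_histories)
  have i1: "integrable (P k) (\<lambda>y. dist c1 (F (Suc k) z1 y))"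
    using fin by (intro integrableI_nonneg) (auto simp: Hfun_def c1_def z1_def)
  have "integrable (P k) (\<lambda>y. dist (F (Suc k) z y) (F (Suc k) z1 y) + dist c1 (F (Suc k) z1 y) + dist c1 c)"
    by (intro Bochner_Integration.integrable_add integrable_dist_F z z1 i1) auto
  then show ?thesis
  proof (rule Bochner_Integration.integrable_bound)
    have "dist (F (Suc k) z y) c \<le> dist (F (Suc k) z y) (F (Suc k) z1 y) + dist c1 (F (Suc k) z1 y) + dist c1 c" for y
      using dist_triangle[of "F (Suc k) z y" c "F (Suc k) z1 y"] dist_triangle[of "F (Suc k) z1 y" c c1]
      by (simp add: dist_commute)
    then show "AE y in P k. norm (dist (F (Suc k) z y) c)
        \<le> norm (dist (F (Suc k) z y) (F (Suc k) z1 y) + dist c1 (F (Suc k) z1 y) + dist c1 c)"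
      by (auto intro: order_trans)
  qed simp
qed

text \<open>
  \<open>val m z\<close> is the conditional expectation of \<open>f (X\<^sub>1, \<dots>, X\<^sub>n)\<close> given the state \<open>z\<close> at time \<open>n - m\<close>,
  and \<open>lip m j\<close> its Lipschitz constant in the coordinate \<open>z j\<close>.
\<close>

primrec val :: "nat \<Rightarrow> (nat \<Rightarrow> 'x) \<Rightarrow> real" where
  "val 0 z = f (\<lambda>i. z (n - i))"
| "val (Suc m) z = (\<integral>y. val m (step (n - Suc m) z y) \<partial>P (n - Suc m))"

definition lip :: "nat \<Rightarrow> nat \<Rightarrow> real" where
  "lip m j = 1 + (\<Sum>l<m. adiag a l * a (m - l + j))"

lemma one_le_adiag: "1 \<le> adiag a m"
  using adiag_ge_1[of a m] a_nonneg by simp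

text \<open>At \<open>j = 0\<close> the defining sum is the renewal form of a_m(m); this is where
  these numbers enter.\<close>

lemma lip_0: "lip m 0 = adiag a m"
  using adiag_eq_sum[of a m] by (simp add: lip_def)

text \<open>After a step, \<open>z j\<close> sits at index \<open>Suc j\<close>, which gives
  \<open>lip m (Suc j)\<close>. It also influences the new entry, of weight
  \<open>lip m 0 = adiag a m\<close>, through the contraction coefficient
  \<open>a (Suc j)\<close>.\<close>

lemma lip_Suc: "lip (Suc m) j = adiag a m * a (Suc j) + lip m (Suc j)"
proof -
  have "(\<Sum>l<m. adiag a l * a (Suc m - l + j)) = (\<Sum>l<m. adiag a l * a (m - l + Suc j))"
    by (intro sum.cong) (auto simp: Suc_diff_le)
  then show ?thesis by (simp add: lip_def)
qed

text \<open>Measurability is required on the whole sequence space, also off the histories, where the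
  integral may be the default value 0.\<close>

lemma val_measurable [measurable]: "val m \<in> borel_measurable N"
proof (induction m)
  case 0
  have "(\<lambda>z i. z (n - i)) \<in> N \<rightarrow>\<^sub>M N"
    by (rule measurable_PiM_single') auto
  from measurable_compose[OF this lipschitz_measurable_PiM[OF f_lipschitz]]
  show ?case by simp
next
  case (Suc m)
  interpret L: prob_space "P (n - Suc m)" by (rule prob_space_P)
  have "(\<lambda>(z, y). val m (step (n - Suc m) z y)) \<in> borel_measurable (N \<Otimes>\<^sub>M borel)"
    using measurable_compose[OF step_measurable Suc.IH] by (simp add: split_beta)
  then have "(\<lambda>(z, y). val m (step (n - Suc m) z y)) \<in> borel_measurable (N \<Otimes>\<^sub>M P (n - Suc m))"
    by (subst measurable_cong_sets[OF sets_pair_measure_cong[OF refl sets_distr] refl])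
  from L.borel_measurable_lebesgue_integral[OF this]
  show ?case by simp
qed

lemma val_step_measurable [measurable]: "(\<lambda>(z, y). val m (step k z y)) \<in> borel_measurable (N \<Otimes>\<^sub>M borel)"
  using measurable_compose[OF step_measurable val_measurable] by (simp add: split_beta)

lemma val_step_measurable_snd [measurable]: "(\<lambda>y. val m (step k z y)) \<in> borel_measurable borel"
  using measurable_compose[OF measurable_Pair1'[of z N borel] val_step_measurable[of m k]] by simp

text \<open>Used with \<open>y = y'\<close> to hand the Lipschitz bound on to the next average, and
  with \<open>z = z'\<close>, where the second sum vanishes, for integrability and for the size of
  the increments. The bound for \<open>val m\<close> is an assumption here because it and
  integrability have to be proved in one induction.\<close>

lemma lipschitz_step_diff:
  assumes lipm: "\<forall>z\<in>histories (n - m). \<forall>z'\<in>histories (n - m).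
      \<bar>val m z - val m z'\<bar> \<le> (\<Sum>j<n - m. lip m j * dist (z j) (z' j))"
    and m: "Suc m \<le> n" and z: "z \<in> histories (n - Suc m)" and z': "z' \<in> histories (n - Suc m)"
  shows "\<bar>val m (step (n - Suc m) z y) - val m (step (n - Suc m) z' y')\<bar>
    \<le> adiag a m * dist (F (Suc (n - Suc m)) z y) (F (Suc (n - Suc m)) z' y')
      + (\<Sum>j<n - Suc m. lip m (Suc j) * dist (z j) (z' j))"
proof -
  have nm: "n - m = Suc (n - Suc m)" using m by simp
  have "step (n - Suc m) z y \<in> histories (n - m)" "step (n - Suc m) z' y' \<in> histories (n - m)"
    unfolding nm by (rule step_histories[OF z] step_histories[OF z'])+
  with lipm have "\<bar>val m (step (n - Suc m) z y) - val m (step (n - Suc m) z' y')\<bar>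
      \<le> (\<Sum>j<Suc (n - Suc m). lip m j * dist (step (n - Suc m) z y j) (step (n - Suc m) z' y' j))"
    unfolding nm by blast
  then show ?thesis
    unfolding sum.lessThan_Suc_shift by (simp add: step_def lip_0)
qed

lemma integrable_val_step_aux:
  assumes lipm: "\<forall>z\<in>histories (n - m). \<forall>z'\<in>histories (n - m).
      \<bar>val m z - val m z'\<bar> \<le> (\<Sum>j<n - m. lip m j * dist (z j) (z' j))"
    and m: "Suc m \<le> n" and z: "z \<in> histories (n - Suc m)"
  shows "integrable (P (n - Suc m)) (\<lambda>y. val m (step (n - Suc m) z y))"
proof -
  interpret L: prob_space "P (n - Suc m)" by (rule prob_space_P)
  define k where "k = n - Suc m"
  have k: "k < n" using m by (simp add: k_def)
  \<comment> \<open>An arbitrary reference point: for \<open>z = z'\<close> the value at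
    \<open>y\<close> differs from the value at \<open>y0\<close> by at most a multiple of an
    integrable distance.\<close>
  define y0 :: 'y where "y0 = undefined"
  define c where "c = F (Suc k) z y0"
  have i: "integrable (P k) (\<lambda>y. adiag a m * dist (F (Suc k) z y) c + \<bar>val m (step k z y0)\<bar>)"
    using integrable_dist_F_const[OF z[folded k_def] k, of c] by (simp add: k_def)
  have "\<bar>val m (step k z y)\<bar> \<le> adiag a m * dist (F (Suc k) z y) c + \<bar>val m (step k z y0)\<bar>" for y
  proof -
    have "\<bar>val m (step k z y) - val m (step k z y0)\<bar> \<le> adiag a m * dist (F (Suc k) z y) c"
      using lipschitz_step_diff[OF lipm m z z, of y y0] by (simp add: k_def c_def)
    then show ?thesis by linarith
  qed
  then show ?thesis
    unfolding k_def[symmetric]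
    by (intro Bochner_Integration.integrable_bound[OF i] AE_I2)
      (simp, metis abs_ge_self order_trans real_norm_def)
qed

lemma val_lipschitz:
  assumes "m \<le> n" "z \<in> histories (n - m)" "z' \<in> histories (n - m)"
  shows "\<bar>val m z - val m z'\<bar> \<le> (\<Sum>j<n - m. lip m j * dist (z j) (z' j))"
  using assms
proof (induction m arbitrary: z z')
  case 0
  have "\<bar>val 0 z - val 0 z'\<bar> \<le> (\<Sum>i=1..n. dist (z (n - i)) (z' (n - i)))"
    using f_lipschitz[of "\<lambda>i. z (n - i)" "\<lambda>i. z' (n - i)"] by simp
  also have "\<dots> = (\<Sum>i<n. dist (z (n - Suc i)) (z' (n - Suc i)))"
    using sum.atLeast1_atMost_eq[of "\<lambda>i. dist (z (n - i)) (z' (n - i))" n] by simp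
  also have "\<dots> = (\<Sum>j<n. dist (z j) (z' j))"
    by (rule sum.nat_diff_reindex)
  finally show ?case by (simp add: lip_def)
next
  case (Suc m)
  define k where "k = n - Suc m"
  interpret L: prob_space "P k" by (rule prob_space_P)
  have m: "m \<le> n" using Suc.prems by simp
  have lipm: "\<forall>z\<in>histories (n - m). \<forall>z'\<in>histories (n - m).
      \<bar>val m z - val m z'\<bar> \<le> (\<Sum>j<n - m. lip m j * dist (z j) (z' j))"
    using Suc.IH m by blast
  have zk: "z \<in> histories k" "z' \<in> histories k" using Suc.prems by (simp_all add: k_def)
  have A: "adiag a m \<ge> 0" using one_le_adiag[of m] by simp
  let ?R = "\<Sum>j<k. lip m (Suc j) * dist (z j) (z' j)"
  let ?d = "\<lambda>y. dist (F (Suc k) z y) (F (Suc k) z' y)"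
  have i: "integrable (P k) (\<lambda>y. val m (step k z y))" "integrable (P k) (\<lambda>y. val m (step k z' y))"
    using integrable_val_step_aux[OF lipm] Suc.prems by (simp_all add: k_def)
  \<comment> \<open>Both histories are driven by the same innovation \<open>y\<close>, which is the
    coupling in the contraction assumption.\<close>
  have "\<bar>val (Suc m) z - val (Suc m) z'\<bar> = \<bar>\<integral>y. val m (step k z y) - val m (step k z' y) \<partial>P k\<bar>"
    using i by (simp add: k_def)
  also have "\<dots> \<le> (\<integral>y. \<bar>val m (step k z y) - val m (step k z' y)\<bar> \<partial>P k)"
    by (rule integral_abs_bound)
  also have "\<dots> \<le> (\<integral>y. adiag a m * ?d y + ?R \<partial>P k)"
  proof (rule integral_mono)
    show "integrable (P k) (\<lambda>y. adiag a m * ?d y + ?R)"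
      using integrable_dist_F[OF zk] by simp
    show "\<bar>val m (step k z y) - val m (step k z' y)\<bar> \<le> adiag a m * ?d y + ?R" for y
      using lipschitz_step_diff[OF lipm] Suc.prems by (simp add: k_def)
  qed (use i in simp)
  also have "\<dots> = adiag a m * (\<integral>y. ?d y \<partial>P k) + ?R"
    using integrable_dist_F[OF zk] L.prob_space by simp
  also have "\<dots> \<le> adiag a m * (\<Sum>j<k. a (Suc j) * dist (z j) (z' j)) + ?R"
    using integral_dist_F_le[OF zk] A by (intro add_right_mono mult_left_mono)
  also have "\<dots> = (\<Sum>j<k. lip (Suc m) j * dist (z j) (z' j))"
    by (simp add: lip_Suc sum_distrib_left sum.distrib distrib_right mult.assoc)
  finally show ?case by (simp add: k_def)
qed

lemma integrable_val_step:
  assumes "Suc m \<le> n" "z \<in> histories (n - Suc m)"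
  shows "integrable (P (n - Suc m)) (\<lambda>y. val m (step (n - Suc m) z y))"
  by (rule integrable_val_step_aux) (use assms val_lipschitz in auto)

section \<open>The increments and the centred functional\<close>

definition A :: real where "A = adiag a (n - 1)"

lemma A_pos: "A > 0"
  unfolding A_def using one_le_adiag[of "n - 1"] by simp

definition H :: "nat \<Rightarrow> (nat \<Rightarrow> 'x) \<times> 'y \<Rightarrow> real" where
  "H k = (\<lambda>(z, y). enn2real (Hfun (P k) (F (Suc k)) z y))"

text \<open>Division by \<open>A\<close> makes \<open>H k\<close> itself the envelope, so that the
  exponential moment assumption applies without rescaling; in return the threshold \<open>x\<close>
  becomes \<open>x / A\<close>.\<close>

definition incr :: "nat \<Rightarrow> (nat \<Rightarrow> 'x) \<times> 'y \<Rightarrow> real" where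
  "incr k = (\<lambda>(z, y). (val (n - Suc k) (step k z y) - val (n - k) z) / A)"

text \<open>Finiteness holds at every history and every \<open>e\<close>, not just almost surely, so
  \<open>enn2real\<close> in \<open>H\<close> loses nothing along the chain.\<close>

lemma Hfun_finite:
  assumes "k < n" "z \<in> histories k"
  shows "Hfun (P k) (F (Suc k)) z e < \<top>"
proof -
  have "integrable (P k) (\<lambda>y. dist (F (Suc k) z e) (F (Suc k) z y))"
    using integrable_dist_F_const[OF assms(2,1), of "F (Suc k) z e"] by (simp add: dist_commute)
  then show ?thesis
    unfolding Hfun_def by (simp add: nn_integral_eq_integral)
qed

lemma H_eq_integral: "H k (z, e) = (\<integral>y. dist (F (Suc k) z e) (F (Suc k) z y) \<partial>P k)"
  unfolding H_def Hfun_def by (simp add: integral_eq_nn_integral)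

lemma H_measurable [measurable]: "H k \<in> borel_measurable (N \<Otimes>\<^sub>M borel)"
  unfolding H_def split_beta by measurable

lemma incr_measurable [measurable]: "incr k \<in> borel_measurable (N \<Otimes>\<^sub>M borel)"
proof -
  have [measurable]: "(\<lambda>v. val (n - Suc k) (step k (fst v) (snd v))) \<in> borel_measurable (N \<Otimes>\<^sub>M borel)"
    using val_step_measurable[of "n - Suc k" k] by (simp add: split_beta)
  show ?thesis
    unfolding incr_def split_beta by measurable
qed

lemma val_eq_integral:
  assumes "k < n"
  shows "val (n - k) z = (\<integral>y. val (n - Suc k) (step k z y) \<partial>P k)"
proof -
  have "n - k = Suc (n - Suc k)" using assms by simp
  then show ?thesis using assms by simp
qed

lemma integrable_val_step':
  assumes "k < n" "z \<in> histories k"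
  shows "integrable (P k) (\<lambda>y. val (n - Suc k) (step k z y))"
  using integrable_val_step[of "n - Suc k" z] assms by simp

lemma integrable_incr:
  assumes "k < n" "z \<in> histories k"
  shows "integrable (P k) (\<lambda>y. incr k (z, y))"
proof -
  interpret L: prob_space "P k" by (rule prob_space_P)
  show ?thesis
    using integrable_val_step'[OF assms] by (simp add: incr_def)
qed

lemma integral_incr:
  assumes "k < n" "z \<in> histories k"
  shows "(\<integral>y. incr k (z, y) \<partial>P k) = 0"
proof -
  interpret L: prob_space "P k" by (rule prob_space_P)
  show ?thesis
    using integrable_val_step'[OF assms] L.prob_space
    by (simp add: incr_def val_eq_integral[OF assms(1)])
qed

text \<open>The subtracted value is the average of \<open>val m (step k z y)\<close> over an
  independent copy \<open>y\<close> of the innovation. Changing \<open>e\<close> to \<open>y\<close>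
  moves only the newest coordinate, whose Lipschitz constant is \<open>adiag a m \<le> A\<close>,
  and the mean of that displacement is \<open>H k (z, e)\<close>.\<close>

lemma abs_incr_le:
  assumes k: "k < n" and z: "z \<in> histories k"
  shows "\<bar>incr k (z, e)\<bar> \<le> H k (z, e)"
proof -
  interpret L: prob_space "P k" by (rule prob_space_P)
  define m where "m = n - Suc k"
  have nk: "k = n - Suc m" "Suc m \<le> n" using k by (auto simp: m_def)
  have lipm: "\<forall>z\<in>histories (n - m). \<forall>z'\<in>histories (n - m).
      \<bar>val m z - val m z'\<bar> \<le> (\<Sum>j<n - m. lip m j * dist (z j) (z' j))"
    using val_lipschitz nk by auto
  have Am: "adiag a m \<le> A"
    using adiag_mono[of a m "n - 1"] a_nonneg k by (simp add: A_def m_def)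
  note i = integrable_val_step'[OF assms, folded m_def]
  have di: "integrable (P k) (\<lambda>y. dist (F (Suc k) z e) (F (Suc k) z y))"
    using integrable_dist_F_const[OF z k, of "F (Suc k) z e"] by (simp add: dist_commute)
  have "\<bar>val m (step k z e) - val (n - k) z\<bar> = \<bar>\<integral>y. val m (step k z e) - val m (step k z y) \<partial>P k\<bar>"
    using i L.prob_space by (simp add: val_eq_integral[OF k, folded m_def])
  also have "\<dots> \<le> (\<integral>y. \<bar>val m (step k z e) - val m (step k z y)\<bar> \<partial>P k)"
    by (rule integral_abs_bound)
  also have "\<dots> \<le> (\<integral>y. A * dist (F (Suc k) z e) (F (Suc k) z y) \<partial>P k)"
  proof (intro integral_mono)
    fix y
    have "\<bar>val m (step k z e) - val m (step k z y)\<bar> \<le> adiag a m * dist (F (Suc k) z e) (F (Suc k) z y)"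
      using lipschitz_step_diff[OF lipm nk(2), of z z e y] z nk by simp
    also have "\<dots> \<le> A * dist (F (Suc k) z e) (F (Suc k) z y)"
      using Am by (intro mult_right_mono) auto
    finally show "\<bar>val m (step k z e) - val m (step k z y)\<bar> \<le> A * dist (F (Suc k) z e) (F (Suc k) z y)" .
  qed (use i di in auto)
  also have "\<dots> = A * H k (z, e)"
    by (simp add: H_eq_integral)
  finally show ?thesis
    using A_pos by (simp add: incr_def m_def[symmetric] abs_divide field_simps)
qed

lemma incr_sum_eq:
  assumes "\<omega> \<in> space M"
  shows "A * (\<Sum>k<n. incr k (state k \<omega>, eps (Suc k) \<omega>)) = f (\<lambda>i. X (int i) \<omega>) - val n init"
proof -
  have "A * (\<Sum>k<n. incr k (state k \<omega>, eps (Suc k) \<omega>))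
      = (\<Sum>k<n. val (n - Suc k) (state (Suc k) \<omega>) - val (n - k) (state k \<omega>))"
    using A_pos assms by (simp add: sum_distrib_left incr_def state_Suc)
  also have "\<dots> = val 0 (state n \<omega>) - val n (state 0 \<omega>)"
    using sum_lessThan_telescope[of "\<lambda>k. val (n - k) (state k \<omega>)" n] by simp
  also have "val 0 (state n \<omega>) = f (\<lambda>i. X (int i) \<omega>)"
  proof -
    \<comment> \<open>Beyond index \<open>n\<close> the two arguments may differ, as
      \<open>n - i\<close> is 0 there; the Lipschitz bound sees only the indices from 1 to
      \<open>n\<close>.\<close>
    have "\<bar>val 0 (state n \<omega>) - f (\<lambda>i. X (int i) \<omega>)\<bar>
        \<le> (\<Sum>i=1..n. dist (state n \<omega> (n - i)) (X (int i) \<omega>))"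
      using f_lipschitz[of "\<lambda>i. state n \<omega> (n - i)" "\<lambda>i. X (int i) \<omega>"] by simp
    also have "\<dots> = 0"
      by (intro sum.neutral) (auto simp: state_def past_def of_nat_diff)
    finally show ?thesis by simp
  qed
  finally show ?thesis
    using assms by (simp add: state_0)
qed

text \<open>By telescoping it remains to see that the mean of \<open>f\<close> is
  \<open>val n init\<close>. The increments are integrable over the whole space, being dominated by
  \<open>H k\<close>, which has finite mean, and so their expectations vanish.\<close>

lemma centered_f_eq:
  assumes "\<omega> \<in> space M"
  shows "centered_f M X f \<omega> = A * (\<Sum>k<n. incr k (state k \<omega>, eps (Suc k) \<omega>))"
proof -
  interpret C: innovation_chain M borel "\<lambda>k. eps (Suc k)" N step state init
    by (rule chain)
  have int: "integrable M (\<lambda>\<omega>. incr k (state k \<omega>, eps (Suc k) \<omega>))" if k: "k < n" for k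
  proof -
    have H: "integrable M (\<lambda>\<omega>. H k (state k \<omega>, eps (Suc k) \<omega>))"
    proof (rule integrableI_nonneg)
      have "(\<integral>\<^sup>+\<omega>. ennreal (H k (state k \<omega>, eps (Suc k) \<omega>)) \<partial>M)
          = (\<integral>\<^sup>+\<omega>. Hfun (P k) (F (Suc k)) (state k \<omega>) (eps (Suc k) \<omega>) \<partial>M)"
        using Hfun_finite[OF k state_histories]
        by (intro nn_integral_cong) (simp add: H_def)
      then show "(\<integral>\<^sup>+\<omega>. ennreal (H k (state k \<omega>, eps (Suc k) \<omega>)) \<partial>M) < \<infinity>"
        using H_integrable[OF k] by simp
      show "(\<lambda>\<omega>. H k (state k \<omega>, eps (Suc k) \<omega>)) \<in> borel_measurable M"
        by measurable
    qed (simp add: H_def)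
    show ?thesis
      by (rule Bochner_Integration.integrable_bound[OF H])
        (auto intro!: order_trans[OF abs_incr_le] k state_histories)
  qed
  have E0: "expectation (\<lambda>\<omega>. incr k (state k \<omega>, eps (Suc k) \<omega>)) = 0" if "k < n" for k
    using that integral_incr state_histories
    by (intro C.expectation_step_eq_0 int) auto
  have "expectation (\<lambda>\<omega>. f (\<lambda>i. X (int i) \<omega>))
      = expectation (\<lambda>\<omega>. val n init + A * (\<Sum>k<n. incr k (state k \<omega>, eps (Suc k) \<omega>)))"
    by (rule Bochner_Integration.integral_cong) (simp_all add: incr_sum_eq)
  also have "\<dots> = val n init + A * expectation (\<lambda>\<omega>. \<Sum>k<n. incr k (state k \<omega>, eps (Suc k) \<omega>))"
  proof -
    have "integrable M (\<lambda>\<omega>. \<Sum>k<n. incr k (state k \<omega>, eps (Suc k) \<omega>))"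
      by (intro Bochner_Integration.integrable_sum int) auto
    then show ?thesis
      by (simp add: prob_space)
  qed
  also have "expectation (\<lambda>\<omega>. \<Sum>k<n. incr k (state k \<omega>, eps (Suc k) \<omega>)) = 0"
    by (subst Bochner_Integration.integral_sum) (auto simp: int E0)
  finally show ?thesis
    by (simp add: centered_f_def incr_sum_eq[OF assms])
qed

lemma tail_centered_f:
  assumes s: "\<bar>s\<bar> = 1" and pos: "0 < n" "0 < x" "0 < u" "0 \<le> C1"
  shows "prob {\<omega> \<in> space M. real n * x \<le> s * centered_f M X f \<omega>}
    \<le> exp (- ((real n * (x / A))\<^sup>2 / (8 * real n * u\<^sup>2)))
      + 4 * real n * C1 / (real n * (x / A))\<^sup>2 * (max (u powr p) (2 / p) powr (2 / p) * exp (- (u powr p)))"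
proof -
  interpret C: innovation_chain M borel "\<lambda>k. eps (Suc k)" N step state init
    by (rule chain)
  have "{\<omega> \<in> space M. real n * x \<le> s * centered_f M X f \<omega>}
      = {\<omega> \<in> space M. real n * (x / A) \<le> (\<Sum>k<n. s * incr k (state k \<omega>, eps (Suc k) \<omega>))}"
    using A_pos by (auto simp: centered_f_eq sum_distrib_left[symmetric] field_simps)
  also have "prob \<dots> \<le> exp (- ((real n * (x / A))\<^sup>2 / (8 * real n * u\<^sup>2)))
      + 4 * real n * C1 / (real n * (x / A))\<^sup>2 * (max (u powr p) (2 / p) powr (2 / p) * exp (- (u powr p)))"
  proof (rule C.tail_bound[where h = H and D = "\<lambda>k v. s * incr k v"])
    fix k assume k: "k < n"
    show "\<bar>s * incr k (state k \<omega>, y)\<bar> \<le> H k (state k \<omega>, y)" if "\<omega> \<in> space M" for \<omega> y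
      using abs_incr_le[OF k state_histories[OF that]] s by (simp add: abs_mult)
    show "integrable (P k) (\<lambda>y. s * incr k (state k \<omega>, y))" if "\<omega> \<in> space M" for \<omega>
      using integrable_incr[OF k state_histories[OF that]] by simp
    show "(\<integral>y. s * incr k (state k \<omega>, y) \<partial>P k) = 0" if "\<omega> \<in> space M" for \<omega>
      using integral_incr[OF k state_histories[OF that]] by simp
    have "(\<integral>\<^sup>+\<omega>. ennreal (exp (H k (state k \<omega>, eps (Suc k) \<omega>) powr p)) \<partial>M)
        = (\<integral>\<^sup>+\<omega>. exp_powr p (Hfun (P k) (F (Suc k)) (past X (Suc k) \<omega>) (eps (Suc k) \<omega>)) \<partial>M)"
      using Hfun_finite[OF k state_histories, THEN less_imp_neq]
      by (intro nn_integral_cong) (simp add: H_def exp_powr_def state_def)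
    then show "(\<integral>\<^sup>+\<omega>. ennreal (exp (H k (state k \<omega>, eps (Suc k) \<omega>) powr p)) \<partial>M) \<le> ennreal C1"
      using exp_moment[of "Suc k"] k by simp
  qed (use pos p_pos A_pos in auto)
  finally show ?thesis .
qed

end

theorem proposition4p5:
  fixes M :: "'w measure"
    and eps :: "nat \<Rightarrow> 'w \<Rightarrow> 'y::polish_space"
    and X :: "int \<Rightarrow> 'w \<Rightarrow> 'x::polish_space"
    and x0 :: "int \<Rightarrow> 'x"
    and F :: "nat \<Rightarrow> (nat \<Rightarrow> 'x) \<Rightarrow> 'y \<Rightarrow> 'x"
    and a :: "nat \<Rightarrow> real"
    and f :: "(nat \<Rightarrow> 'x) \<Rightarrow> real"
    and n :: nat
    and \<alpha> C1 x :: real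
  assumes "prob_space M"
    and "prob_space.indep_vars M (\<lambda>_. borel) eps {1..}"
    and "\<And>m. m \<ge> 1 \<Longrightarrow> (\<lambda>(z, y). F m z y) \<in> (\<Pi>\<^sub>M j\<in>UNIV. borel) \<Otimes>\<^sub>M borel \<rightarrow>\<^sub>M borel"
    and "\<And>i \<omega>. i \<le> 0 \<Longrightarrow> \<omega> \<in> space M \<Longrightarrow> X i \<omega> = x0 i"
    and "\<And>m \<omega>. m \<ge> 1 \<Longrightarrow> \<omega> \<in> space M \<Longrightarrow> X (int m) \<omega> = F m (past X m \<omega>) (eps m \<omega>)"
    and "\<And>i. i \<ge> 1 \<Longrightarrow> a i \<ge> 0"
    and "summable (\<lambda>j. a (Suc j))"
    and "(\<Sum>j. a (Suc j)) < 1"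
    and "\<And>m z z'. m \<ge> 1 \<Longrightarrow>
           (\<integral>\<^sup>+\<omega>. ennreal (dist (F m z (eps m \<omega>)) (F m z' (eps m \<omega>))) \<partial>M)
             \<le> (\<Sum>j. ennreal (a (Suc j) * dist (z j) (z' j)))"
    and "n \<ge> 1"
    and "\<And>u v. \<bar>f u - f v\<bar> \<le> (\<Sum>i=1..n. dist (u i) (v i))"
    and "0 < \<alpha>" and "\<alpha> < 1"
    and "\<And>k. 1 \<le> k \<Longrightarrow> k \<le> n \<Longrightarrow>
           (\<integral>\<^sup>+\<omega>. exp_powr (2 * \<alpha> / (1 - \<alpha>))
                   (Hfun (distr M borel (eps k)) (F k) (past X k \<omega>) (eps k \<omega>)) \<partial>M)
             \<le> ennreal C1"
    and "x > 0"
  shows "measure M {\<omega> \<in> space M. centered_f M X f \<omega> \<ge> real n * x}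
           \<le> Cconst C1 (adiag a (n - 1)) \<alpha> x
               * exp (- ((x / (8 * adiag a (n - 1))) powr (2 * \<alpha>) * real n powr \<alpha>))
         \<and> measure M {\<omega> \<in> space M. - centered_f M X f \<omega> \<ge> real n * x}
           \<le> Cconst C1 (adiag a (n - 1)) \<alpha> x
               * exp (- ((x / (8 * adiag a (n - 1))) powr (2 * \<alpha>) * real n powr \<alpha>))"
proof -
  interpret prob_space M by (rule assms(1))
  define p where "p = 2 * \<alpha> / (1 - \<alpha>)"
  have \<alpha>: "0 < \<alpha>" "\<alpha> < 1" and x: "x > 0" and n: "n \<ge> 1" by fact+
  have p: "p > 0" using \<alpha> by (simp add: p_def)
  interpret R: contracting_recursion M eps X x0 F a f n p C1
    using assms(1)
  proof (rule contracting_recursion.intro, intro contracting_recursion_axioms.intro)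
    show "p > 0" by (rule p)
  qed (unfold p_def, (rule assms; assumption)+)
  \<comment> \<open>The sign of \<open>C1\<close> is not given: \<open>ennreal C1\<close> would be 0
    for negative \<open>C1\<close>, but an exponential moment is at least 1.\<close>
  have "1 \<le> exp_powr p h" for h
    by (auto simp: exp_powr_def simp flip: ennreal_1 intro!: ennreal_leI)
  then have "(\<integral>\<^sup>+\<omega>. 1 \<partial>M)
      \<le> (\<integral>\<^sup>+\<omega>. exp_powr p (Hfun (distr M borel (eps 1)) (F 1) (past X 1 \<omega>) (eps 1 \<omega>)) \<partial>M)"
    by (intro nn_integral_mono)
  also have "\<dots> \<le> ennreal C1"
    by (rule R.exp_moment) (use n in auto)
  finally have "ennreal 1 \<le> ennreal C1"
    by (simp add: emeasure_space_1)
  then have C1: "0 \<le> C1"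
    by (cases "0 \<le> C1") (auto simp: ennreal_neg)
  define y where "y = x / R.A"
  have y: "y > 0" using x R.A_pos by (simp add: y_def)
  define u where "u = (y * sqrt (real n) / 8) powr (1 - \<alpha>)"
  have u: "u > 0" using y n by (simp add: u_def)
  have "prob {\<omega> \<in> space M. real n * x \<le> s * centered_f M X f \<omega>}
      \<le> Cconst C1 R.A \<alpha> x * exp (- ((x / (8 * R.A)) powr (2 * \<alpha>) * real n powr \<alpha>))"
    if s: "\<bar>s\<bar> = 1" for s
  proof -
    have "prob {\<omega> \<in> space M. real n * x \<le> s * centered_f M X f \<omega>}
        \<le> exp (- ((real n * y)\<^sup>2 / (8 * real n * u\<^sup>2)))
          + 4 * real n * C1 / (real n * y)\<^sup>2 * (max (u powr p) (2 / p) powr (2 / p) * exp (- (u powr p)))"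
      unfolding y_def by (rule R.tail_centered_f) (use s n x u C1 in auto)
    also have "\<dots> \<le> (2 + 35 * C1 * (1 / (y powr (2 * \<alpha>) * 4 powr (2 - 3 * \<alpha>))
          + 4 / y\<^sup>2 * (3 * (1 - \<alpha>) / (2 * \<alpha>)) powr ((1 - \<alpha>) / \<alpha>)))
          * exp (- ((y / 8) powr (2 * \<alpha>) * real n powr \<alpha>))"
      unfolding u_def p_def by (rule tail_constants) (use \<alpha> y n C1 in auto)
    also have "2 + 35 * C1 * (1 / (y powr (2 * \<alpha>) * 4 powr (2 - 3 * \<alpha>))
          + 4 / y\<^sup>2 * (3 * (1 - \<alpha>) / (2 * \<alpha>)) powr ((1 - \<alpha>) / \<alpha>)) = Cconst C1 R.A \<alpha> x"
    proof -
      have "y powr (2 * \<alpha>) = x powr (2 * \<alpha>) / R.A powr (2 * \<alpha>)"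
        using x R.A_pos by (simp add: y_def powr_divide)
      then show ?thesis
        using R.A_pos x by (simp add: Cconst_def y_def power_divide)
    qed
    also have "y / 8 = x / (8 * R.A)"
      by (simp add: y_def)
    finally show ?thesis .
  qed
  from this[of 1] this[of "-1"] show ?thesis
    by (simp add: R.A_def)
qed

end
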